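(* Let $(x(n),\gamma(n))_{n\ge0}$ be the iterates of the stochastic zeroth-order saddle point mirror descent (SZSPMD) algorithm, with gradient-estimator biases $b_x(n),b_\gamma(n)$. For any $\epsilon>0$ there exists $\mathbf B>0$ such that if $\|b_x(n)\|\le\mathbf B$ and $\|b_\gamma(n)\|\le\mathbf B$ for all $n$, then almost surely there exists $n_0\in\mathbb N$ such that for all $n\ge n_0$, $(x(n),\gamma(n))\in N_\epsilon(\mathcal S)$.
   Context: Setting. $\mathcal X\subseteq\mathbb R^n$, $\mathcal Y\subseteq\mathbb R^m$ are nonempty, convex and compact. $L:\mathbb R^n\times\mathbb R^m\to\mathbb R$ is continuously differentiable, convex in $x$ and concave in $\gamma$. A saddle point is $(x^*,\gamma^* )\in\mathcal X\times\mathcal Y$ with $L(x^*,\gamma)\le L(x^*,\gamma^* )\le L(x,\gamma^* )$ for all $x\in\mathcal X,\gamma\in\mathcal Y$; $\mathcal S$ is the set of saddle points. $d(z,\mathcal A)=\inf_{a\in\mathcal A}\|a-z\|$ and $N_\epsilon(\mathcal A)=\{z: d(z,\mathcal A)\le\epsilon\}$. Assumptions. (A1) $\mathcal S$ is nonempty and compact, and for every $(x,\gamma)\in(\mathcal X\times\mathcal Y)\setminus\mathcal S$ there is $(x^*,\gamma^* )\in\mathcal S$ with $L(x^*,\gamma)<L(x^*,\gamma^* )$ or $L(x^*,\gamma^* )<L(x,\gamma^* )$. (A2) (semicontinuity of $L$ in each variable) holds automatically here. (A3) There is $G>0$ with $\|\nabla_xL(x,\gamma)\|\le G$ and $\|\nabla_\gamma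 L(x,\gamma)\|\le G$ for all $(x,\gamma)\in\mathcal X\times\mathcal Y$. (A6) $\sum_n\alpha(n)=\infty$, $\sum_n\alpha(n)^2<\infty$ for the step sizes below. (A7) There is $K_2>0$ with $\|\nabla^2R_x(x_1)-\nabla^2R_x(x_2)\|\le K_2\|x_1-x_2\|$ for $x_1,x_2\in\mathcal X$ and $\|\nabla^2R_\gamma(\gamma_1)-\nabla^2R_\gamma(\gamma_2)\|\le K_2\|\gamma_1-\gamma_2\|$ for $\gamma_1,\gamma_2\in\mathcal Y$. (A8) There is $\rho_L>0$ with $\|\nabla L(x_1,\gamma_1)-\nabla L(x_2,\gamma_2)\|\le\rho_L\|(x_1,\gamma_1)-(x_2,\gamma_2)\|$ for all $(x_1,\gamma_1),(x_2,\gamma_2)\in\mathcal X\times\mathcal Y$. $R_x$ (on $\mathbb R^n$) and $R_\gamma$ (on $\mathbb R^m$) are extended-real-valued functions, twice continuously differentiable and $\sigma_R$-strongly convex ($\sigma_R>0$) on open sets containing $\mathcal X$ and $\mathcal Y$ respectively, and $\rho_R$-smooth (their gradients are $\rho_R$-Lipschitz). SZSPMD algorithm. Let $\bar R_x=R_x+\mathcal I_{\mathcal X}$, $\bar R_\gamma=R_\gamma+\mathcal I_{\mathcal Y}$ ($\mathcal I$ = indicator function), with conjugates satisfying $\nabla\bar R_x^*(y)=\operatorname{argmax}_{z\in\mathcal X}\{\langle z,y\rangle-R_x(z)\}$, $\nabla\bar R_\gamma^*(\delta)=\operatorname{argmax}_{z\in\mathcal Y}\{\langle z,\delta\rangle-R_\gamma(z)\}$.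 Let $\mu(n)>0$ be smoothing parameters and $\alpha(n)>0$ step sizes. Start from $(x(0),\gamma(0))\in\mathcal X\times\mathcal Y$. At step $n$ draw a fresh standard normal vector $u(n)\sim\mathcal N(0,I_{n+m})$ in $\mathbb R^{n+m}$, independent of the past, set $$\tilde\nabla L(x(n),\gamma(n))=\frac{L\big((x(n),\gamma(n))+\mu(n)u(n)\big)-L(x(n),\gamma(n))}{\mu(n)}\,u(n)=\big(\tilde\nabla_xL(x(n),\gamma(n)),\tilde\nabla_\gamma L(x(n),\gamma(n))\big)\in\mathbb R^n\times\mathbb R^m,$$ and update $$x(n+1)=\nabla\bar R_x^*\big(\nabla R_x(x(n))-\alpha(n)\tilde\nabla_xL(x(n),\gamma(n))\big),\qquad \gamma(n+1)=\nabla\bar R_\gamma^*\big(\nabla R_\gamma(\gamma(n))+\alpha(n)\tilde\nabla_\gamma L(x(n),\gamma(n))\big).$$ Let $\mathcal F_n=\sigma(x(i),\gamma(i):0\le i\le n)$ and let the biases be $b_x(n)=\mathbb E[\tilde\nabla_xL(x(n),\gamma(n))|\mathcal F_n]-\nabla_xL(x(n),\gamma(n))$, $b_\gamma(n)=\mathbb E[\tilde\nabla_\gamma L(x(n),\gamma(n))|\mathcal F_n]-\nabla_\gamma L(x(n),\gamma(n))$. The following properties of the estimator are taken as given: there are constants $C,\mathcal K>0$ such that almost surely for all $n$, $\|(b_x(n),b_\gamma(n))\|\le C\mu(n)$ and $\mathbb E[\|\tilde\nabla L(x(n),\gamma(n))\|^2|\mathcal F_n]\le\mathcal K$. *)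

theory Defs
  imports "HOL-Probability.Probability"
begin

section \<open>Gradients and Hessians\<close>

definition grad :: "('a::real_inner \<Rightarrow> real) \<Rightarrow> 'a \<Rightarrow> 'a" where
  "grad f x = (THE D. GDERIV f x :> D)"

text \<open>The norm of \<open>hessian f x\<close> is the operator norm.\<close>

definition hessian :: "('a::real_inner \<Rightarrow> real) \<Rightarrow> 'a \<Rightarrow> 'a \<Rightarrow>\<^sub>L 'a" where
  "hessian f x = Blinfun (frechet_derivative (grad f) (at x))"

definition grad_fst :: "('a::real_inner \<times> 'b::real_inner \<Rightarrow> real) \<Rightarrow> 'a \<times> 'b \<Rightarrow> 'a" where
  "grad_fst L z = grad (\<lambda>x. L (x, snd z)) (fst z)"

definition grad_snd :: "('a::real_inner \<times> 'b::real_inner \<Rightarrow> real) \<Rightarrow> 'a \<times> 'b \<Rightarrow> 'b" where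
  "grad_snd L z = grad (\<lambda>y. L (fst z, y)) (snd z)"

definition continuously_differentiable :: "('a::real_inner \<Rightarrow> real) \<Rightarrow> bool" where
  "continuously_differentiable f \<longleftrightarrow>
     (\<forall>x. f differentiable (at x)) \<and> continuous_on UNIV (grad f)"

definition twice_continuously_differentiable_on ::
    "'a::real_inner set \<Rightarrow> ('a \<Rightarrow> real) \<Rightarrow> bool" where
  "twice_continuously_differentiable_on U f \<longleftrightarrow>
     (\<forall>x\<in>U. f differentiable (at x)) \<and> (\<forall>x\<in>U. grad f differentiable (at x)) \<and>
     continuous_on U (hessian f)"

definition strongly_convex_on :: "real \<Rightarrow> 'a::real_normed_vector set \<Rightarrow> ('a \<Rightarrow> real) \<Rightarrow> bool" where
  "strongly_convex_on \<sigma> U f \<longleftrightarrow> convex U \<and>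
     (\<forall>x\<in>U. \<forall>y\<in>U. \<forall>u\<ge>0. \<forall>v\<ge>0. u + v = 1 \<longrightarrow>
        f (u *\<^sub>R x + v *\<^sub>R y) \<le> u * f x + v * f y - \<sigma> / 2 * u * v * (norm (x - y))\<^sup>2)"

section \<open>Saddle points\<close>

definition saddle_points ::
    "'a set \<Rightarrow> 'b set \<Rightarrow> ('a \<times> 'b \<Rightarrow> real) \<Rightarrow> ('a \<times> 'b) set" where
  "saddle_points X Y L = {(xs, ys). xs \<in> X \<and> ys \<in> Y \<and>
     (\<forall>x\<in>X. \<forall>y\<in>Y. L (xs, y) \<le> L (xs, ys) \<and> L (xs, ys) \<le> L (x, ys))}"

definition neighbourhood :: "real \<Rightarrow> 'a::metric_space set \<Rightarrow> 'a set" where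
  "neighbourhood \<epsilon> A = {z. infdist z A \<le> \<epsilon>}"

section \<open>Regularizers, conjugates and mirror maps\<close>

text \<open>An extended-real-valued function used as a regularizer for \<open>X\<close>: its regularity is only
  required on an open set containing \<open>X\<close>, on which it is finite.\<close>

definition regularizer ::
    "real \<Rightarrow> real \<Rightarrow> 'a::real_inner set \<Rightarrow> ('a \<Rightarrow> ereal) \<Rightarrow> bool" where
  "regularizer \<sigma> \<rho> X R \<longleftrightarrow> (\<exists>U. open U \<and> X \<subseteq> U \<and> (\<forall>x\<in>U. \<bar>R x\<bar> \<noteq> \<infinity>) \<and>
     twice_continuously_differentiable_on U (\<lambda>x. real_of_ereal (R x)) \<and>
     strongly_convex_on \<sigma> U (\<lambda>x. real_of_ereal (R x)) \<and>
     \<rho>-lipschitz_on U (grad (\<lambda>x. real_of_ereal (R x))))"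

definition cvx_indicator :: "'a set \<Rightarrow> 'a \<Rightarrow> ereal" where
  "cvx_indicator X z = (if z \<in> X then 0 else \<infinity>)"

definition conjugate :: "('a::real_inner \<Rightarrow> ereal) \<Rightarrow> 'a \<Rightarrow> ereal" where
  "conjugate f y = (SUP z. ereal (z \<bullet> y) - f z)"

definition mirror_map :: "'a::real_inner set \<Rightarrow> ('a \<Rightarrow> ereal) \<Rightarrow> 'a \<Rightarrow> 'a" where
  "mirror_map X R = grad (\<lambda>y. real_of_ereal (conjugate (\<lambda>z. R z + cvx_indicator X z) y))"

lemma grad_eqI:
  assumes "GDERIV f x :> D"
  shows "grad f x = D"
  unfolding grad_def
proof (rule the_equality[where P = "\<lambda>D. GDERIV f x :> D"])
  show "GDERIV f x :> D" by fact
next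
  fix D' assume "GDERIV f x :> D'"
  then have "(\<lambda>h. h \<bullet> D') = (\<lambda>h. h \<bullet> D)"
    using assms unfolding gderiv_def by (rule has_derivative_unique)
  then have "(D' - D) \<bullet> D' = (D' - D) \<bullet> D" by (rule fun_cong)
  then have "(D' - D) \<bullet> (D' - D) = 0" by (simp only: inner_diff_right)
  then show "D' = D" by simp
qed

text \<open>The gradient of the conjugate is the (unique) maximiser over \<open>X\<close>.\<close>

lemma mirror_map_argmax:
  fixes X :: "'a::euclidean_space set"
  assumes X: "X \<noteq> {}" "convex X" "compact X" and \<sigma>: "\<sigma> > 0" and R: "regularizer \<sigma> \<rho> X R"
  shows "mirror_map X R y \<in> X"
    and "z \<in> X \<Longrightarrow> z \<noteq> mirror_map X R y \<Longrightarrow>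
           z \<bullet> y - real_of_ereal (R z) < mirror_map X R y \<bullet> y - real_of_ereal (R (mirror_map X R y))"
proof -
  define f where "f = (\<lambda>x. real_of_ereal (R x))"
  obtain U where U: "open U" "X \<subseteq> U" "\<And>x. x \<in> U \<Longrightarrow> \<bar>R x\<bar> \<noteq> \<infinity>"
    "\<And>x. x \<in> U \<Longrightarrow> f differentiable (at x)" "strongly_convex_on \<sigma> U f"
    using R unfolding regularizer_def twice_continuously_differentiable_on_def f_def[symmetric]
    by (elim exE conjE) (rule that; simp)
  have Rf: "R x = ereal (f x)" if "x \<in> X" for x
    using U(3)[of x] U(2) that unfolding f_def by (subst ereal_real') auto
  have cont: "continuous_on X f"
    using U(2) by (intro continuous_at_imp_continuous_on ballI differentiable_imp_continuous_within U(4)) auto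
  have "\<exists>p\<in>X. \<forall>z\<in>X. z \<bullet> y - f z \<le> p \<bullet> y - f p" for y
    using X(1,3) by (intro continuous_attains_sup continuous_intros cont)
  then obtain p where pX: "\<And>y. p y \<in> X" and pmax: "\<And>y z. z \<in> X \<Longrightarrow> z \<bullet> y - f z \<le> p y \<bullet> y - f (p y)"
    by metis
  have gap: "\<sigma> / 4 * (norm (z - p y))\<^sup>2 \<le> (p y \<bullet> y - f (p y)) - (z \<bullet> y - f z)" if z: "z \<in> X" for y z
  proof -
    let ?w = "(1/2::real) *\<^sub>R z + (1/2::real) *\<^sub>R p y"
    have "?w \<in> X" using X(2) z pX[of y] unfolding convex_def by auto
    then have "?w \<bullet> y - f ?w \<le> p y \<bullet> y - f (p y)" by (rule pmax)
    moreover have "f ?w \<le> 1/2 * f z + 1/2 * f (p y) - \<sigma> / 2 * (1/2) * (1/2) * (norm (z - p y))\<^sup>2"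
    proof -
      have "z \<in> U" "p y \<in> U" using U(2) z pX by auto
      moreover have "(0::real) \<le> 1/2" "(1/2::real) + 1/2 = 1" by simp_all
      ultimately show ?thesis using U(5) unfolding strongly_convex_on_def by blast
    qed
    moreover have "?w \<bullet> y = 1/2 * (z \<bullet> y) + 1/2 * (p y \<bullet> y)" by (simp add: inner_add_left)
    ultimately show ?thesis by simp
  qed
  have lip: "norm (p y' - p y) \<le> 2 / \<sigma> * norm (y' - y)" for y y'
  proof (cases "p y' = p y")
    case False
    have "\<sigma> / 2 * (norm (p y' - p y))\<^sup>2 \<le> (p y' - p y) \<bullet> (y' - y)"
      using gap[OF pX, of y y'] gap[OF pX, of y' y]
      by (simp add: inner_diff_left inner_diff_right norm_minus_commute)
    also have "\<dots> \<le> norm (p y' - p y) * norm (y' - y)" by (rule norm_cauchy_schwarz)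
    finally have "\<sigma> / 2 * norm (p y' - p y) \<le> norm (y' - y)"
      using False by (simp add: power2_eq_square)
    then show ?thesis using \<sigma> by (simp add: field_simps)
  qed (use \<sigma> in auto)
  define c where "c = (\<lambda>y. real_of_ereal (conjugate (\<lambda>z. R z + cvx_indicator X z) y))"
  have c: "c y = p y \<bullet> y - f (p y)" for y
  proof -
    have "conjugate (\<lambda>z. R z + cvx_indicator X z) y = ereal (p y \<bullet> y - f (p y))"
      unfolding conjugate_def
    proof (rule antisym[OF SUP_least SUP_upper2[of "p y"]])
      fix z show "ereal (z \<bullet> y) - (R z + cvx_indicator X z) \<le> ereal (p y \<bullet> y - f (p y))"
        using pmax[of z y] by (auto simp: cvx_indicator_def Rf)
    qed (use pX[of y] in \<open>auto simp: cvx_indicator_def Rf\<close>)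
    then show ?thesis by (simp add: c_def)
  qed
  have bnd: "norm (c y' - c y - (y' - y) \<bullet> p y) \<le> 2 / \<sigma> * norm (y' - y) * norm (y' - y)" for y y'
  proof -
    have "0 \<le> c y' - c y - (y' - y) \<bullet> p y"
      using pmax[OF pX, of y y'] by (simp add: c inner_diff_left inner_diff_right inner_commute)
    moreover have "c y' - c y - (y' - y) \<bullet> p y \<le> (p y' - p y) \<bullet> (y' - y)"
      using pmax[OF pX, of y' y] by (simp add: c inner_diff_left inner_diff_right inner_commute)
    moreover have "\<dots> \<le> norm (p y' - p y) * norm (y' - y)" by (rule norm_cauchy_schwarz)
    moreover have "\<dots> \<le> 2 / \<sigma> * norm (y' - y) * norm (y' - y)"
      by (intro mult_right_mono lip) auto
    ultimately show ?thesis by simp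
  qed
  have "GDERIV c y :> p y" for y
    unfolding gderiv_def has_derivative_at_alt
  proof (intro conjI allI impI bounded_linear_inner_left)
    fix e :: real assume e: "0 < e"
    show "\<exists>d>0. \<forall>y'. norm (y' - y) < d \<longrightarrow> norm (c y' - c y - (y' - y) \<bullet> p y) \<le> e * norm (y' - y)"
    proof (intro exI[of _ "e * \<sigma> / 2"] conjI allI impI)
      fix y' assume "norm (y' - y) < e * \<sigma> / 2"
      then have "2 / \<sigma> * norm (y' - y) \<le> e" using \<sigma> by (simp add: field_simps)
      then have "2 / \<sigma> * norm (y' - y) * norm (y' - y) \<le> e * norm (y' - y)"
        by (rule mult_right_mono) simp
      then show "norm (c y' - c y - (y' - y) \<bullet> p y) \<le> e * norm (y' - y)" using bnd order_trans by blast
    qed (use e \<sigma> in auto)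
  qed
  then have mp: "mirror_map X R y = p y" for y
    unfolding mirror_map_def c_def[symmetric] by (rule grad_eqI)
  show "mirror_map X R y \<in> X" by (simp add: mp pX)
  assume "z \<in> X" "z \<noteq> mirror_map X R y"
  then have "0 < \<sigma> / 4 * (norm (z - p y))\<^sup>2" using \<sigma> by (simp add: mp)
  then show "z \<bullet> y - real_of_ereal (R z)
      < mirror_map X R y \<bullet> y - real_of_ereal (R (mirror_map X R y))"
    using gap[OF \<open>z \<in> X\<close>, of y] by (simp add: mp f_def)
qed

section \<open>Probabilistic notions\<close>

definition standard_normal :: "'w measure \<Rightarrow> ('w \<Rightarrow> 'a::euclidean_space) \<Rightarrow> bool" where
  "standard_normal M u \<longleftrightarrow>
     distributed M lborel u (\<lambda>v. ennreal (\<Prod>b\<in>Basis. std_normal_density (v \<bullet> b)))"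

definition generated_sigma ::
    "'w measure \<Rightarrow> 'i set \<Rightarrow> ('i \<Rightarrow> 'w \<Rightarrow> 'a::topological_space) \<Rightarrow> 'w measure" where
  "generated_sigma M I X =
     sigma (space M) (\<Union>i\<in>I. {X i -` A \<inter> space M | A. A \<in> sets borel})"

text \<open>The library's conditional expectation is real-valued; this is its coordinatewise extension.\<close>

definition vec_cond_exp ::
    "'w measure \<Rightarrow> 'w measure \<Rightarrow> ('w \<Rightarrow> 'a::euclidean_space) \<Rightarrow> 'w \<Rightarrow> 'a" where
  "vec_cond_exp M F f \<omega> = (\<Sum>b\<in>Basis. real_cond_exp M F (\<lambda>\<omega>. f \<omega> \<bullet> b) \<omega> *\<^sub>R b)"

section \<open>Stochastic zeroth-order saddle point mirror descent\<close>

definition zo_grad :: "('a::real_vector \<Rightarrow> real) \<Rightarrow> real \<Rightarrow> 'a \<Rightarrow> 'a \<Rightarrow> 'a" where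
  "zo_grad L \<mu> z u = ((L (z + \<mu> *\<^sub>R u) - L z) / \<mu>) *\<^sub>R u"

text \<open>The past at step \<open>n\<close>, from which \<open>u n\<close> has to be independent, is generated by
  \<open>z 0, \<dots>, z n\<close> and \<open>u 0, \<dots>, u (n - 1)\<close>.\<close>

definition szspmd_past ::
    "'w measure \<Rightarrow> (nat \<Rightarrow> 'w \<Rightarrow> 'a::topological_space) \<Rightarrow> (nat \<Rightarrow> 'w \<Rightarrow> 'a) \<Rightarrow> nat \<Rightarrow> 'w measure" where
  "szspmd_past M u z n =
     sigma (space M) (sets (generated_sigma M {..n} z) \<union> sets (generated_sigma M {..<n} u))"

definition szspmd ::
    "'a::euclidean_space set \<Rightarrow> 'b::euclidean_space set \<Rightarrow> ('a \<times> 'b \<Rightarrow> real) \<Rightarrow>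
     ('a \<Rightarrow> ereal) \<Rightarrow> ('b \<Rightarrow> ereal) \<Rightarrow> (nat \<Rightarrow> real) \<Rightarrow> (nat \<Rightarrow> real) \<Rightarrow>
     'w measure \<Rightarrow> (nat \<Rightarrow> 'w \<Rightarrow> 'a \<times> 'b) \<Rightarrow> (nat \<Rightarrow> 'w \<Rightarrow> 'a \<times> 'b) \<Rightarrow> bool" where
  "szspmd X Y L Rx Ry \<alpha> \<mu> M u z \<longleftrightarrow>
     prob_space M \<and> (\<forall>n. \<alpha> n > 0) \<and> (\<forall>n. \<mu> n > 0) \<and>
     (\<forall>n. z n \<in> borel_measurable M) \<and>
     (\<forall>n. standard_normal M (u n)) \<and>
     (\<forall>n. prob_space.indep_set M
            (sets (generated_sigma M {n} u)) (sets (szspmd_past M u z n))) \<and>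
     (\<forall>\<omega>\<in>space M. z 0 \<omega> \<in> X \<times> Y) \<and>
     (\<forall>n. \<forall>\<omega>\<in>space M. z (Suc n) \<omega> =
        (mirror_map X Rx (grad (\<lambda>x. real_of_ereal (Rx x)) (fst (z n \<omega>))
           - \<alpha> n *\<^sub>R fst (zo_grad L (\<mu> n) (z n \<omega>) (u n \<omega>))),
         mirror_map Y Ry (grad (\<lambda>y. real_of_ereal (Ry y)) (snd (z n \<omega>))
           + \<alpha> n *\<^sub>R snd (zo_grad L (\<mu> n) (z n \<omega>) (u n \<omega>)))))"

definition bias_fst ::
    "('a::euclidean_space \<times> 'b::euclidean_space \<Rightarrow> real) \<Rightarrow> (nat \<Rightarrow> real) \<Rightarrow> 'w measure \<Rightarrow>
     (nat \<Rightarrow> 'w \<Rightarrow> 'a \<times> 'b) \<Rightarrow> (nat \<Rightarrow> 'w \<Rightarrow> 'a \<times> 'b) \<Rightarrow> nat \<Rightarrow> 'w \<Rightarrow> 'a" where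
  "bias_fst L \<mu> M u z n \<omega> =
     vec_cond_exp M (generated_sigma M {..n} z) (\<lambda>\<omega>. fst (zo_grad L (\<mu> n) (z n \<omega>) (u n \<omega>))) \<omega>
     - grad_fst L (z n \<omega>)"

definition bias_snd ::
    "('a::euclidean_space \<times> 'b::euclidean_space \<Rightarrow> real) \<Rightarrow> (nat \<Rightarrow> real) \<Rightarrow> 'w measure \<Rightarrow>
     (nat \<Rightarrow> 'w \<Rightarrow> 'a \<times> 'b) \<Rightarrow> (nat \<Rightarrow> 'w \<Rightarrow> 'a \<times> 'b) \<Rightarrow> nat \<Rightarrow> 'w \<Rightarrow> 'b" where
  "bias_snd L \<mu> M u z n \<omega> =
     vec_cond_exp M (generated_sigma M {..n} z) (\<lambda>\<omega>. snd (zo_grad L (\<mu> n) (z n \<omega>) (u n \<omega>))) \<omega>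
     - grad_snd L (z n \<omega>)"

text \<open>The second moment uses the conditional expectation of nonnegative functions, so that the
  bound includes square-integrability.\<close>

definition estimator_bounds ::
    "('a::euclidean_space \<times> 'b::euclidean_space \<Rightarrow> real) \<Rightarrow> (nat \<Rightarrow> real) \<Rightarrow> 'w measure \<Rightarrow>
     (nat \<Rightarrow> 'w \<Rightarrow> 'a \<times> 'b) \<Rightarrow> (nat \<Rightarrow> 'w \<Rightarrow> 'a \<times> 'b) \<Rightarrow> real \<Rightarrow> real \<Rightarrow> bool" where
  "estimator_bounds L \<mu> M u z C K \<longleftrightarrow>
     (AE \<omega> in M. \<forall>n.
        norm (bias_fst L \<mu> M u z n \<omega>, bias_snd L \<mu> M u z n \<omega>) \<le> C * \<mu> n \<and>
        nn_cond_exp M (generated_sigma M {..n} z)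
          (\<lambda>\<omega>. ennreal ((norm (zo_grad L (\<mu> n) (z n \<omega>) (u n \<omega>)))\<^sup>2)) \<omega> \<le> ennreal K)"

end

theory Submission
  imports Defs
begin

text \<open>
  Why the theorem holds.  Let \<open>D p z\<close> be the sum of the Bregman divergences of the two regularizers.  One step of
  the algorithm satisfies, for every \<open>p\<close> in \<open>X \<times> Y\<close>,
  \<open>D p z(n+1) \<le> D p z(n) - \<alpha>(n) (F(z(n)) \<bullet> (z(n) - p)) + \<alpha>(n) \<beta> + e(n)\<close>,
  where \<open>F = (\<nabla>\<^sub>x L, - \<nabla>\<^sub>y L)\<close>, the number \<open>\<beta>\<close> is proportional to the bound on the biases, and \<open>e(n)\<close> consists of the
  noise and of the quadratic error (\<open>joint_bregman_mirror_step\<close>).  Almost surely both parts give convergent series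
  (\<open>szspmd_estimator\<close>): the quadratic part since second moments are bounded and \<open>\<Sum>\<alpha>(n)\<^sup>2\<close> converges, the noise since
  it forms a martingale bounded in \<open>L\<^sup>2\<close> (\<open>AE_summable_orthogonal\<close>).  What remains is deterministic.

  For a saddle point \<open>p\<close>, convexity and concavity make \<open>F(z) \<bullet> (z - p)\<close> nonnegative, so apart from \<open>e\<close> the divergence from
  \<open>p\<close> can only grow through the bias.  It need not decrease, however: the pairing with a given saddle point can vanish far away from
  the set \<open>S\<close> of saddle points, and the distance to \<open>S\<close> is not a strict Lyapunov function.  But off \<open>S\<close> the pairing is
  positive for some saddle point that depends on \<open>z\<close>, so on a compact set away from \<open>S\<close> it is bounded below by some
  \<open>h > 0\<close> for a suitable average \<open>pbar\<close> of finitely many saddle points (\<open>uniform_descent_direction\<close>).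

  The two facts are combined in \<open>eventually_stays_near\<close>.  While the iterates are away from \<open>S\<close>, the bounded quantity
  \<open>D pbar\<close> falls at rate at least \<open>h / 2\<close> per unit of \<open>\<Sum>\<alpha>\<close>.  Hence the iterates visit a neighbourhood of \<open>S\<close>, and each
  excursion from it has a duration that is bounded in terms of the problem data.  During one excursion the divergence
  from the saddle point that was near at its start grows by at most \<open>\<beta>\<close> times this duration, up to the tails of
  convergent series; if the biases are small enough, this keeps the iterates within \<open>\<epsilon>\<close> of \<open>S\<close>.
  Only finitely many reference points occur, so the exceptional null sets cause no difficulty.
\<close>

section \<open>Convexity and Bregman divergences\<close>

text \<open>A real-valued derivative on a Euclidean space is a linear functional, hence represented by a vector;
  so the definite description in \<open>grad\<close> is always met at points of differentiability.\<close>

lemma GDERIV_grad: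
  fixes f :: "'a::euclidean_space \<Rightarrow> real"
  assumes "f differentiable (at x)"
  shows "GDERIV f x :> grad f x"
proof -
  obtain f' where f': "(f has_derivative f') (at x)"
    using assms unfolding differentiable_def by blast
  then have lin: "linear f'" by (rule has_derivative_linear)
  have "f' = (\<lambda>h. h \<bullet> (\<Sum>b\<in>Basis. f' b *\<^sub>R b))"
  proof
    fix h
    have "f' h = f' (\<Sum>b\<in>Basis. (h \<bullet> b) *\<^sub>R b)" by (simp add: euclidean_representation)
    also have "\<dots> = (\<Sum>b\<in>Basis. (h \<bullet> b) * f' b)"
      using lin by (simp add: linear_sum linear_scale)
    finally show "f' h = h \<bullet> (\<Sum>b\<in>Basis. f' b *\<^sub>R b)"
      by (simp add: inner_sum_right mult.commute)
  qed
  with f' have "GDERIV f x :> (\<Sum>b\<in>Basis. f' b *\<^sub>R b)"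
    unfolding gderiv_def by metis
  then show ?thesis by (metis grad_eqI)
qed

lemma GDERIV_line:
  fixes f :: "'a::real_inner \<Rightarrow> real"
  assumes "GDERIV f x :> D"
  shows "((\<lambda>t. f (x + t *\<^sub>R d)) has_real_derivative D \<bullet> d) (at 0)"
proof -
  have "((\<lambda>t::real. x + t *\<^sub>R d) has_derivative (\<lambda>t. t *\<^sub>R d)) (at 0)"
    by (auto intro!: derivative_eq_intros)
  moreover have "(f has_derivative (\<lambda>h. h \<bullet> D)) (at (x + 0 *\<^sub>R d))"
    using assms by (simp add: gderiv_def)
  ultimately have "((\<lambda>t. f (x + t *\<^sub>R d)) has_derivative (\<lambda>t. (t *\<^sub>R d) \<bullet> D)) (at 0)"
    by (rule has_derivative_compose)
  moreover have "(\<lambda>t. (t *\<^sub>R d) \<bullet> D) = (*) (D \<bullet> d)" by (auto simp: inner_commute)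
  ultimately show ?thesis by (simp add: has_field_derivative_def)
qed

lemma derivative_nonpos_if_max_right:
  fixes \<phi> :: "real \<Rightarrow> real"
  assumes d: "(\<phi> has_real_derivative l) (at 0)" and m: "\<And>t. 0 < t \<Longrightarrow> t \<le> 1 \<Longrightarrow> \<phi> t \<le> \<phi> 0"
  shows "l \<le> 0"
proof (rule ccontr)
  assume "\<not> l \<le> 0"
  then obtain e where e: "e > 0" "\<And>h. h > 0 \<Longrightarrow> h < e \<Longrightarrow> \<phi> 0 < \<phi> (0 + h)"
    using DERIV_pos_inc_right[OF d] by auto
  have "\<phi> 0 < \<phi> (0 + min (e/2) 1)" using e by (intro e(2)) auto
  moreover have "\<phi> (min (e/2) 1) \<le> \<phi> 0" using e by (intro m) auto
  ultimately show False by simp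
qed

text \<open>The inequality along the segment from \<open>x\<close> to \<open>y\<close>, after subtracting its right-hand side, is a function of
  the segment parameter that is maximal at \<open>0\<close>; its one-sided derivative there is the claim.  With \<open>\<sigma> = 0\<close> this
  is the usual tangent inequality for convex functions.\<close>

lemma strongly_convex_on_tangent:
  fixes f :: "'a::real_inner \<Rightarrow> real"
  assumes sc: "strongly_convex_on \<sigma> U f" and x: "x \<in> U" and y: "y \<in> U" and D: "GDERIV f x :> D"
  shows "f x + D \<bullet> (y - x) + \<sigma> / 2 * (norm (y - x))\<^sup>2 \<le> f y"
proof -
  define c where "c = \<sigma> / 2 * (norm (y - x))\<^sup>2"
  define \<phi> where "\<phi> = (\<lambda>t. f (x + t *\<^sub>R (y - x)) - t * (f y - f x - c) - t\<^sup>2 * c)"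
  have "(\<phi> has_real_derivative D \<bullet> (y - x) - (f y - f x - c)) (at 0)"
    unfolding \<phi>_def using GDERIV_line[OF D, of "y - x"] by (auto intro!: derivative_eq_intros)
  moreover have "\<phi> t \<le> \<phi> 0" if "0 < t" "t \<le> 1" for t
  proof -
    have "f ((1 - t) *\<^sub>R x + t *\<^sub>R y)
        \<le> (1 - t) * f x + t * f y - \<sigma> / 2 * (1 - t) * t * (norm (x - y))\<^sup>2"
      using sc x y that unfolding strongly_convex_on_def by auto
    moreover have "(1 - t) *\<^sub>R x + t *\<^sub>R y = x + t *\<^sub>R (y - x)" by (simp add: algebra_simps)
    moreover have "\<sigma> / 2 * (1 - t) * t * (norm (x - y))\<^sup>2 = t * c - t\<^sup>2 * c"
      unfolding c_def norm_minus_commute[of y x] by (simp add: field_simps power2_eq_square)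
    ultimately show ?thesis by (simp add: \<phi>_def algebra_simps)
  qed
  ultimately have "D \<bullet> (y - x) - (f y - f x - c) \<le> 0" by (rule derivative_nonpos_if_max_right)
  then show ?thesis by (simp add: c_def)
qed

lemma strongly_convex_on_zero: "strongly_convex_on 0 U f \<longleftrightarrow> convex_on U f"
  by (auto simp: strongly_convex_on_def convex_on_def)

definition bregman :: "('a::real_inner \<Rightarrow> ereal) \<Rightarrow> 'a \<Rightarrow> 'a \<Rightarrow> real" where
  "bregman R p z = real_of_ereal (R p) - real_of_ereal (R z)
     - grad (\<lambda>x. real_of_ereal (R x)) z \<bullet> (p - z)"

lemma bregman_self [simp]: "bregman R p p = 0"
  by (simp add: bregman_def)

lemma bregman_ge:
  fixes X :: "'a::euclidean_space set"
  assumes R: "regularizer \<sigma> \<rho> X R" and "p \<in> X" "z \<in> X"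
  shows "\<sigma> / 2 * (norm (p - z))\<^sup>2 \<le> bregman R p z"
proof -
  obtain U where U: "X \<subseteq> U" "\<And>x. x \<in> U \<Longrightarrow> (\<lambda>x. real_of_ereal (R x)) differentiable (at x)"
    "strongly_convex_on \<sigma> U (\<lambda>x. real_of_ereal (R x))"
    using R unfolding regularizer_def twice_continuously_differentiable_on_def by blast
  have "GDERIV (\<lambda>x. real_of_ereal (R x)) z :> grad (\<lambda>x. real_of_ereal (R x)) z"
    using U assms by (intro GDERIV_grad) auto
  from strongly_convex_on_tangent[OF U(3) _ _ this, of p] U(1) assms(2,3)
  have "real_of_ereal (R z) + grad (\<lambda>x. real_of_ereal (R x)) z \<bullet> (p - z) + \<sigma> / 2 * (norm (p - z))\<^sup>2
      \<le> real_of_ereal (R p)" by blast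
  then show ?thesis by (simp add: bregman_def)
qed

lemma continuous_on_bregman:
  fixes X :: "'a::euclidean_space set"
  assumes R: "regularizer \<sigma> \<rho> X R"
  shows "continuous_on X (bregman R p)"
proof -
  obtain U where U: "X \<subseteq> U" "\<And>x. x \<in> U \<Longrightarrow> (\<lambda>x. real_of_ereal (R x)) differentiable (at x)"
    "\<rho>-lipschitz_on U (grad (\<lambda>x. real_of_ereal (R x)))"
    using R unfolding regularizer_def twice_continuously_differentiable_on_def by blast
  have "continuous_on X (\<lambda>x. real_of_ereal (R x))"
    using U by (intro continuous_at_imp_continuous_on ballI differentiable_imp_continuous_within) auto
  moreover have "continuous_on X (grad (\<lambda>x. real_of_ereal (R x)))"
    using U lipschitz_on_continuous_on continuous_on_subset by blast
  ultimately show ?thesis unfolding bregman_def by (intro continuous_intros)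
qed

text \<open>First-order optimality of the maximiser of \<open>z \<mapsto> z \<bullet> y - R z\<close> over the convex set \<open>X\<close>: the objective does not
  increase along any segment that leaves the maximiser inside \<open>X\<close>.\<close>

lemma mirror_map_variational:
  fixes X :: "'a::euclidean_space set"
  assumes X: "X \<noteq> {}" "convex X" "compact X" and \<sigma>: "\<sigma> > 0" and R: "regularizer \<sigma> \<rho> X R"
    and p: "p \<in> X"
  shows "0 \<le> (grad (\<lambda>x. real_of_ereal (R x)) (mirror_map X R y) - y) \<bullet> (p - mirror_map X R y)"
proof -
  define f where "f = (\<lambda>x. real_of_ereal (R x))"
  define w where "w = mirror_map X R y"
  note argmax = mirror_map_argmax[OF X \<sigma> R, where y = y, folded w_def]
  have w: "w \<in> X" by (rule argmax(1))
  obtain U where U: "X \<subseteq> U" "\<And>x. x \<in> U \<Longrightarrow> f differentiable (at x)"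
    using R unfolding regularizer_def twice_continuously_differentiable_on_def f_def[symmetric] by blast
  define \<phi> where "\<phi> = (\<lambda>t. (w + t *\<^sub>R (p - w)) \<bullet> y - f (w + t *\<^sub>R (p - w)))"
  have "GDERIV f w :> grad f w" using U w by (intro GDERIV_grad) auto
  from GDERIV_line[OF this, of "p - w"]
  have "(\<phi> has_real_derivative (p - w) \<bullet> y - grad f w \<bullet> (p - w)) (at 0)"
    unfolding \<phi>_def inner_add_left inner_scaleR_left by (auto intro!: derivative_eq_intros)
  moreover have "\<phi> t \<le> \<phi> 0" if "0 < t" "t \<le> 1" for t
  proof -
    have "(1 - t) *\<^sub>R w + t *\<^sub>R p \<in> X" using X(2) w p that by (intro convexD) auto
    moreover have "(1 - t) *\<^sub>R w + t *\<^sub>R p = w + t *\<^sub>R (p - w)" by (simp add: algebra_simps)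
    ultimately show ?thesis using argmax(2)[where z = "w + t *\<^sub>R (p - w)"]
      by (cases "w + t *\<^sub>R (p - w) = w") (auto simp: \<phi>_def f_def)
  qed
  ultimately have "(p - w) \<bullet> y - grad f w \<bullet> (p - w) \<le> 0" by (rule derivative_nonpos_if_max_right)
  then show ?thesis unfolding w_def[symmetric] f_def[symmetric]
    by (simp only: inner_diff_left inner_diff_right inner_commute[of y])
qed

text \<open>The basic estimate of mirror descent with an arbitrary displacement \<open>v\<close> in the dual space: the three-point
  identity of the divergence combined with optimality of the new point.  The quadratic term pays for replacing the
  new point by the old one in the pairing with \<open>v\<close>.\<close>

lemma bregman_mirror_step:
  fixes X :: "'a::euclidean_space set" and v :: 'a
  assumes X: "X \<noteq> {}" "convex X" "compact X" and \<sigma>: "\<sigma> > 0" and R: "regularizer \<sigma> \<rho> X R"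
    and p: "p \<in> X" and z: "z \<in> X"
  defines "w \<equiv> mirror_map X R (grad (\<lambda>x. real_of_ereal (R x)) z - v)"
  shows "bregman R p w \<le> bregman R p z - v \<bullet> (z - p) + (norm v)\<^sup>2 / (2 * \<sigma>)"
proof -
  define f where "f = (\<lambda>x. real_of_ereal (R x))"
  have w: "w \<in> X" unfolding w_def by (rule mirror_map_argmax(1)[OF X \<sigma> R])
  have var: "0 \<le> (grad f w - (grad f z - v)) \<bullet> (p - w)"
    using mirror_map_variational[OF X \<sigma> R p] unfolding w_def f_def .
  have three_point: "bregman R p w = bregman R p z - bregman R w z + (grad f z - grad f w) \<bullet> (p - w)"
    unfolding bregman_def f_def[symmetric]
    by (simp add: inner_diff_left inner_diff_right)
  have "v \<bullet> (z - w) \<le> norm v * norm (w - z)"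
    by (metis norm_cauchy_schwarz norm_minus_commute)
  \<comment> \<open>Young's inequality balances the displacement against the strong convexity of the regularizer.\<close>
  also have "\<dots> \<le> (norm v)\<^sup>2 / (2 * \<sigma>) + \<sigma> / 2 * (norm (w - z))\<^sup>2"
  proof -
    have "0 \<le> (norm v - \<sigma> * norm (w - z))\<^sup>2 / (2 * \<sigma>)" using \<sigma> by simp
    also have "\<dots> = (norm v)\<^sup>2 / (2 * \<sigma>) + \<sigma> / 2 * (norm (w - z))\<^sup>2 - norm v * norm (w - z)"
      using \<sigma> by (simp add: power2_eq_square field_simps)
    finally show ?thesis by simp
  qed
  also have "\<sigma> / 2 * (norm (w - z))\<^sup>2 \<le> bregman R w z" by (rule bregman_ge[OF R w z])
  finally have "v \<bullet> (z - w) \<le> (norm v)\<^sup>2 / (2 * \<sigma>) + bregman R w z" by simp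
  with var three_point show ?thesis
    by (simp add: inner_diff_left inner_diff_right)
qed

section \<open>Descent directions and bounded excursions\<close>

lemma finite_positive_subfamily:
  fixes f :: "'p \<Rightarrow> 'a::metric_space \<Rightarrow> real"
  assumes K: "compact K" and f: "\<And>p. p \<in> P \<Longrightarrow> continuous_on K (f p)"
    and pos: "\<And>z. z \<in> K \<Longrightarrow> \<exists>p\<in>P. 0 < f p z"
  obtains C where "finite C" "C \<subseteq> P" "\<And>z. z \<in> K \<Longrightarrow> \<exists>p\<in>C. 0 < f p z"
proof -
  have "\<exists>T. open T \<and> T \<inter> K = f p -` {0<..} \<inter> K" if "p \<in> P" for p
  proof -
    have "openin (top_of_set K) (K \<inter> f p -` {0<..})"
      using f[OF that] by (intro continuous_openin_preimage_gen) auto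
    then show ?thesis by (auto simp: openin_open Int_commute)
  qed
  then obtain T where T: "\<And>p. p \<in> P \<Longrightarrow> open (T p)"
    "\<And>p. p \<in> P \<Longrightarrow> T p \<inter> K = f p -` {0<..} \<inter> K" by metis
  have "K \<subseteq> (\<Union>p\<in>P. T p)" using pos T(2) by fastforce
  with K T(1) obtain C where C: "C \<subseteq> P" "finite C" "K \<subseteq> (\<Union>p\<in>C. T p)"
    by (rule compactE_image)
  show ?thesis
  proof (rule that[OF C(2,1)])
    fix z assume "z \<in> K"
    then show "\<exists>p\<in>C. 0 < f p z" using C T(2) by fastforce
  qed
qed

text \<open>A single point of \<open>S\<close> may leave the pairing zero at some points of \<open>K\<close>.  Compactness gives finitely many points
  of \<open>S\<close> of which at least one is strictly good at each \<open>z\<close>; since all the others contribute nonnegatively and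
  \<open>z - p\<close> is affine in \<open>p\<close>, their barycentre is strictly good everywhere, and uniformly so by compactness.\<close>

lemma uniform_descent_direction:
  fixes g :: "'a::real_inner \<Rightarrow> 'a"
  assumes K: "compact K" and g: "continuous_on K g" and S: "S \<noteq> {}"
    and nonneg: "\<And>p z. p \<in> S \<Longrightarrow> z \<in> K \<Longrightarrow> 0 \<le> g z \<bullet> (z - p)"
    and pos: "\<And>z. z \<in> K \<Longrightarrow> \<exists>p\<in>S. 0 < g z \<bullet> (z - p)"
  obtains pbar h where "pbar \<in> convex hull S" "h > 0" "\<And>z. z \<in> K \<Longrightarrow> h \<le> g z \<bullet> (z - pbar)"
proof -
  obtain C0 where C0: "finite C0" "C0 \<subseteq> S" "\<And>z. z \<in> K \<Longrightarrow> \<exists>p\<in>C0. 0 < g z \<bullet> (z - p)"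
    by (rule finite_positive_subfamily[where f = "\<lambda>p z. g z \<bullet> (z - p)", OF K _ pos])
      (auto intro!: continuous_intros g)
  obtain s where "s \<in> S" using S by blast
  define C where "C = insert s C0"
  have C: "finite C" "C \<subseteq> S" "\<And>z. z \<in> K \<Longrightarrow> \<exists>p\<in>C. 0 < g z \<bullet> (z - p)" "C \<noteq> {}"
    using C0 \<open>s \<in> S\<close> by (auto simp: C_def)
  have card: "real (card C) > 0" using C by (simp add: card_gt_0_iff)
  define pbar where "pbar = (\<Sum>p\<in>C. (1 / card C) *\<^sub>R p)"
  have pbar: "pbar \<in> convex hull S"
    unfolding pbar_def using C card by (intro convex_sum convex_convex_hull) (auto intro: hull_inc)
  have avg: "z - pbar = (\<Sum>p\<in>C. (1 / card C) *\<^sub>R (z - p))" for z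
    using card by (simp add: pbar_def scaleR_diff_right sum_subtractf sum_constant_scaleR)
  have s_pos: "0 < g z \<bullet> (z - pbar)" if z: "z \<in> K" for z
  proof -
    obtain q where "q \<in> C" "0 < g z \<bullet> (z - q)" using C(3)[OF z] by blast
    then show ?thesis
      unfolding avg inner_sum_right inner_scaleR_right using C z card
      by (intro sum_pos2[of C q]) (auto intro!: divide_nonneg_pos nonneg)
  qed
  have cont: "continuous_on K (\<lambda>z. g z \<bullet> (z - pbar))" by (intro continuous_intros g)
  have "\<exists>h>0. \<forall>z\<in>K. h \<le> g z \<bullet> (z - pbar)"
  proof (cases "K = {}")
    case False
    then obtain z0 where "z0 \<in> K" "\<And>z. z \<in> K \<Longrightarrow> g z0 \<bullet> (z0 - pbar) \<le> g z \<bullet> (z - pbar)"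
      using continuous_attains_inf[OF K _ cont] by blast
    then show ?thesis using s_pos by blast
  qed (auto intro: exI[of _ 1])
  then show ?thesis using pbar that by blast
qed

lemma sum_Suc_telescope_le:
  fixes V d :: "nat \<Rightarrow> real"
  assumes "m \<le> n" and "\<And>k. m \<le> k \<Longrightarrow> k < n \<Longrightarrow> V (Suc k) \<le> V k + d k"
  shows "V n \<le> V m + (\<Sum>k=m..<n. d k)"
  using assms
proof (induction n rule: dec_induct)
  case (step n)
  have "V (Suc n) \<le> V n + d n" using step by auto
  moreover have "V n \<le> V m + (\<Sum>k=m..<n. d k)" using step by auto
  ultimately show ?case using step.hyps by simp
qed simp

lemma summable_sums_eventually_small:
  fixes e :: "nat \<Rightarrow> real"
  assumes "summable e" and "\<eta> > 0"
  shows "\<forall>\<^sub>F N in sequentially. \<forall>m\<ge>N. \<forall>n. (\<Sum>k=m..<n. e k) \<le> \<eta>"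
proof -
  obtain N where N: "\<forall>m\<ge>N. \<forall>n. norm (sum e {m..<n}) < \<eta>"
    using assms by (auto simp: summable_Cauchy)
  have "(\<Sum>k=m..<n. e k) \<le> \<eta>" if "N \<le> m" for m n
  proof -
    have "\<bar>sum e {m..<n}\<bar> < \<eta>" using N that by (simp flip: real_norm_def)
    then show ?thesis by simp
  qed
  then show ?thesis
    by (intro eventually_sequentiallyI[of N] allI impI) auto
qed

text \<open>The heart of the argument, for real sequences.  Each \<open>V q\<close> measures the distance to one target, grows with drift
  at most \<open>\<beta>\<close> per unit of time (time being the sum of the steps \<open>\<alpha>\<close>) and is otherwise perturbed by convergent series.
  As long as no target is near, the bounded quantity \<open>W\<close> falls at rate \<open>h\<close>.  Since \<open>W\<close> lies in \<open>{0..w}\<close>, no excursion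
  away from the targets lasts longer than about \<open>(w + 1) / h\<close>, and in such a time a small \<open>\<beta>\<close> adds at
  most \<open>\<eta>\<close> to the \<open>V q\<close> of the target that was left.  The divergence of \<open>\<Sum>\<alpha>\<close> enforces that a target is ever approached.\<close>

lemma eventually_stays_near:
  fixes \<alpha> W e' :: "nat \<Rightarrow> real" and V e :: "'q \<Rightarrow> nat \<Rightarrow> real"
  assumes Q: "finite Q"
    and \<alpha>: "\<And>n. 0 \<le> \<alpha> n" "\<not> summable \<alpha>" "\<alpha> \<longlonglongrightarrow> 0"
    and e: "\<And>q. q \<in> Q \<Longrightarrow> summable (e q)" "summable e'"
    and h: "h > 0" and \<eta>: "\<eta> > 0" and \<beta>: "0 \<le> \<beta>" "\<beta> * (1 + (w + 1) / h) \<le> \<eta>"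
    and V: "\<And>q n. q \<in> Q \<Longrightarrow> V q (Suc n) \<le> V q n + \<alpha> n * \<beta> + e q n"
    and W: "\<And>n. (\<And>q. q \<in> Q \<Longrightarrow> \<eta> \<le> V q n) \<Longrightarrow> W (Suc n) \<le> W n - \<alpha> n * h + e' n"
    and W_bounds: "\<And>n. 0 \<le> W n" "\<And>n. W n \<le> w"
  shows "\<exists>n0. \<forall>n\<ge>n0. \<exists>q\<in>Q. V q n \<le> 3 * \<eta>"
proof -
  have "\<forall>\<^sub>F N in sequentially. \<forall>q\<in>Q. \<forall>m\<ge>N. \<forall>n. (\<Sum>k=m..<n. e q k) \<le> \<eta>"
    using Q e \<eta> by (intro eventually_ball_finite ballI summable_sums_eventually_small) auto
  moreover have "\<forall>\<^sub>F N in sequentially. \<forall>m\<ge>N. \<forall>n. (\<Sum>k=m..<n. e' k) \<le> 1"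
    using e by (intro summable_sums_eventually_small) auto
  moreover have "\<forall>\<^sub>F N in sequentially. \<forall>m\<ge>N. \<alpha> m < 1"
    using order_tendstoD(2)[OF \<alpha>(3), of 1] by (simp add: eventually_all_ge_at_top)
  ultimately have "\<forall>\<^sub>F N in sequentially. (\<forall>q\<in>Q. \<forall>m\<ge>N. \<forall>n. (\<Sum>k=m..<n. e q k) \<le> \<eta>) \<and>
      (\<forall>m\<ge>N. \<forall>n. (\<Sum>k=m..<n. e' k) \<le> 1) \<and> (\<forall>m\<ge>N. \<alpha> m < 1)"
    by (intro eventually_conj)
  from eventually_happens'[OF sequentially_bot this]
  obtain N where N: "\<And>q m n. q \<in> Q \<Longrightarrow> N \<le> m \<Longrightarrow> (\<Sum>k=m..<n. e q k) \<le> \<eta>"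
    "\<And>m n. N \<le> m \<Longrightarrow> (\<Sum>k=m..<n. e' k) \<le> 1" "\<And>m. N \<le> m \<Longrightarrow> \<alpha> m < 1"
    by meson
  define near where "near = (\<lambda>n. \<exists>q\<in>Q. V q n < \<eta>)"
  have time_away: "(\<Sum>k=m..<n. \<alpha> k) \<le> (w + 1) / h"
    if "N \<le> m" "m \<le> n" and away: "\<And>k. m \<le> k \<Longrightarrow> k < n \<Longrightarrow> \<not> near k" for m n
  proof -
    have "W n \<le> W m + (\<Sum>k=m..<n. e' k - \<alpha> k * h)"
    proof (rule sum_Suc_telescope_le[OF \<open>m \<le> n\<close>])
      fix k assume "m \<le> k" "k < n"
      then have "\<And>q. q \<in> Q \<Longrightarrow> \<eta> \<le> V q k" using away by (force simp: near_def)
      from W[OF this] show "W (Suc k) \<le> W k + (e' k - \<alpha> k * h)" by simp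
    qed
    also have "\<dots> = W m + (\<Sum>k=m..<n. e' k) - (\<Sum>k=m..<n. \<alpha> k) * h"
      by (simp add: sum_subtractf sum_distrib_right)
    finally have "(\<Sum>k=m..<n. \<alpha> k) * h \<le> w + 1"
      using N(2)[OF \<open>N \<le> m\<close>, of n] W_bounds(1)[of n] W_bounds(2)[of m] by simp
    then show ?thesis using h by (simp add: field_simps)
  qed
  obtain n1 where n1: "n1 \<ge> N" "near n1"
  proof -
    have "\<exists>n\<ge>N. near n"
    proof (rule ccontr)
      assume "\<not> ?thesis"
      then have bound: "(\<Sum>k=N..<n. \<alpha> k) \<le> (w + 1) / h" if "N \<le> n" for n
        using that by (intro time_away) auto
      have "(\<Sum>k<n. \<alpha> (k + N)) \<le> (w + 1) / h" for n
      proof -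
        have "(\<Sum>k<n. \<alpha> (k + N)) = (\<Sum>k=N..<n+N. \<alpha> k)"
          using sum.shift_bounds_nat_ivl[of \<alpha> 0 N n] by (simp add: lessThan_atLeast0)
        then show ?thesis using bound[of "n + N"] by simp
      qed
      then have "summable (\<lambda>k. \<alpha> (k + N))"
        using \<alpha>(1) by (intro bounded_imp_summable[where B = "(w + 1) / h"])
          (simp_all only: lessThan_Suc_atMost[symmetric])
      then show False using \<alpha>(2) summable_iff_shift by blast
    qed
    then show ?thesis using that by blast
  qed
  have "\<exists>q\<in>Q. V q n \<le> 3 * \<eta>" if "n \<ge> n1" for n
  proof -
    define m where "m = (GREATEST k. k \<le> n \<and> near k)"
    have ex: "n1 \<le> n \<and> near n1" using that n1 by simp
    have m: "m \<le> n" "near m"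
      using GreatestI_nat[of "\<lambda>k. k \<le> n \<and> near k", OF ex, of n] by (auto simp: m_def)
    have m_ge: "k \<le> m" if "k \<le> n" "near k" for k
      unfolding m_def using that by (intro Greatest_le_nat[where b = n]) auto
    have "n1 \<le> m" using ex by (intro m_ge) auto
    then have "N \<le> m" using n1 by simp
    obtain q where q: "q \<in> Q" "V q m < \<eta>" using m by (auto simp: near_def)
    show ?thesis
    proof (cases "m = n")
      case True
      then show ?thesis using q \<eta> by force
    next
      case False
      \<comment> \<open>The excursion leaves through one step of length at most 1; after it, every index is away.\<close>
      have "(\<Sum>k=m..<n. \<alpha> k) = \<alpha> m + (\<Sum>k=Suc m..<n. \<alpha> k)"
        using m(1) False by (simp add: sum.atLeast_Suc_lessThan)
      moreover have "(\<Sum>k=Suc m..<n. \<alpha> k) \<le> (w + 1) / h"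
      proof (rule time_away)
        fix k assume k: "Suc m \<le> k" "k < n"
        show "\<not> near k" using m_ge[of k] k by auto
      qed (use m(1) False \<open>N \<le> m\<close> in auto)
      ultimately have T: "(\<Sum>k=m..<n. \<alpha> k) \<le> 1 + (w + 1) / h"
        using N(3)[OF \<open>N \<le> m\<close>] by simp
      have "V q n \<le> V q m + (\<Sum>k=m..<n. \<alpha> k * \<beta> + e q k)"
        using V[OF q(1)] m(1) by (intro sum_Suc_telescope_le) (auto simp: add.assoc)
      also have "\<dots> = V q m + \<beta> * (\<Sum>k=m..<n. \<alpha> k) + (\<Sum>k=m..<n. e q k)"
        by (simp add: sum.distrib sum_distrib_left mult.commute)
      also have "\<dots> \<le> \<eta> + \<eta> + \<eta>"
        using q(2) N(1)[OF q(1) \<open>N \<le> m\<close>, of n] order_trans[OF mult_left_mono[OF T \<beta>(1)] \<beta>(2)]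
        by simp
      finally show ?thesis using q(1) by (intro bexI[of _ q]) simp_all
    qed
  qed
  then show ?thesis by blast
qed

section \<open>Square-summable martingale differences\<close>

text \<open>Partial sums of \<open>y\<close> frozen at the first index where their modulus reaches \<open>l\<close>.\<close>

fun stopped_sum :: "real \<Rightarrow> (nat \<Rightarrow> real) \<Rightarrow> nat \<Rightarrow> real" where
  "stopped_sum l y 0 = 0"
| "stopped_sum l y (Suc k) = stopped_sum l y k + (if \<bar>stopped_sum l y k\<bar> < l then y k else 0)"

lemma stopped_sum_not_exceeded:
  assumes "\<bar>stopped_sum l y k\<bar> < l"
  shows "stopped_sum l y k = (\<Sum>i<k. y i) \<and> (\<forall>j\<le>k. \<bar>\<Sum>i<j. y i\<bar> < l)"
  using assms
proof (induction k)
  case (Suc k)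
  then have "\<bar>stopped_sum l y k\<bar> < l" by (auto split: if_splits)
  with Suc show ?case by (auto simp: le_Suc_eq)
qed simp

context prob_space
begin

text \<open>Kolmogorov's maximal inequality for increments that are orthogonal to the bounded functions of the past.  The
  event that some partial sum reaches \<open>l\<close> is the event that the final value of the stopped sum does, so Chebyshev's
  inequality applies.  Stopping only deletes increments, and the cross term in the square of a stopped sum pairs an
  increment with a past function bounded by \<open>2 * l\<close>, which is why orthogonality to bounded functions is enough.\<close>

lemma maximal_inequality_orthogonal:
  fixes Y :: "nat \<Rightarrow> 'a \<Rightarrow> real"
  assumes sub: "\<And>n. subalgebra M (G n)"
    and adapted: "\<And>j k. j < k \<Longrightarrow> Y j \<in> borel_measurable (G k)"
    and sq: "\<And>n. integrable M (\<lambda>\<omega>. (Y n \<omega>)\<^sup>2)"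
    and orth: "\<And>n W c. W \<in> borel_measurable (G n) \<Longrightarrow> (\<And>\<omega>. \<bar>W \<omega>\<bar> \<le> c) \<Longrightarrow>
       expectation (\<lambda>\<omega>. W \<omega> * Y n \<omega>) = 0"
    and l: "l > 0"
  shows "prob {\<omega>\<in>space M. \<exists>j\<le>k. l \<le> \<bar>\<Sum>i<j. Y i \<omega>\<bar>} \<le> (\<Sum>i<k. expectation (\<lambda>\<omega>. (Y i \<omega>)\<^sup>2)) / l\<^sup>2"
proof -
  define T where "T = (\<lambda>k \<omega>. stopped_sum l (\<lambda>i. Y i \<omega>) k)"
  have T_Suc: "T (Suc k) = (\<lambda>\<omega>. T k \<omega> + (if \<bar>T k \<omega>\<bar> < l then Y k \<omega> else 0))" for k
    by (simp add: T_def)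
  have YM [measurable]: "Y n \<in> borel_measurable M" for n
    using adapted[of n "Suc n"] sub[of "Suc n"] by (metis lessI measurable_from_subalg)
  have T_adapted: "T k \<in> borel_measurable (G j)" if "k \<le> j" for k j
    using that
  proof (induction k)
    case 0 then show ?case by (simp add: T_def)
  next
    case (Suc k)
    then have [measurable]: "T k \<in> borel_measurable (G j)" "Y k \<in> borel_measurable (G j)"
      using adapted by auto
    show ?case unfolding T_Suc by measurable
  qed
  have TM [measurable]: "T k \<in> borel_measurable M" for k
    using T_adapted[of k k] sub[of k] by (metis order_refl measurable_from_subalg)
  have YI: "integrable M (Y n)" for n by (rule square_integrable_imp_integrable[OF YM sq])
  have T2: "integrable M (\<lambda>\<omega>. (T k \<omega>)\<^sup>2) \<and>
      expectation (\<lambda>\<omega>. (T k \<omega>)\<^sup>2) \<le> (\<Sum>i<k. expectation (\<lambda>\<omega>. (Y i \<omega>)\<^sup>2))" for k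
  proof (induction k)
    case 0 then show ?case by (simp add: T_def)
  next
    case (Suc k)
    define W where "W = (\<lambda>\<omega>. if \<bar>T k \<omega>\<bar> < l then 2 * T k \<omega> else 0)"
    define A where "A = (\<lambda>\<omega>. if \<bar>T k \<omega>\<bar> < l then (Y k \<omega>)\<^sup>2 else 0)"
    have W_bound: "\<bar>W \<omega>\<bar> \<le> 2 * l" for \<omega> using l by (simp add: W_def abs_mult)
    have WG: "W \<in> borel_measurable (G k)"
    proof -
      have [measurable]: "T k \<in> borel_measurable (G k)" by (simp add: T_adapted)
      show ?thesis unfolding W_def by measurable
    qed
    have WM [measurable]: "W \<in> borel_measurable M" unfolding W_def by measurable
    have AM [measurable]: "A \<in> borel_measurable M" unfolding A_def by measurable
    have WY: "integrable M (\<lambda>\<omega>. W \<omega> * Y k \<omega>)"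
    proof (rule Bochner_Integration.integrable_bound)
      show "integrable M (\<lambda>\<omega>. 2 * l * Y k \<omega>)" using YI by simp
      show "AE \<omega> in M. norm (W \<omega> * Y k \<omega>) \<le> norm (2 * l * Y k \<omega>)"
        using W_bound l by (auto simp: abs_mult intro!: mult_right_mono)
    qed simp
    have AI: "integrable M A"
      by (rule Bochner_Integration.integrable_bound[OF sq[of k]]) (auto simp: A_def)
    have AE_le: "expectation A \<le> expectation (\<lambda>\<omega>. (Y k \<omega>)\<^sup>2)"
      by (rule integral_mono[OF AI sq]) (simp add: A_def)
    have eq: "(\<lambda>\<omega>. (T (Suc k) \<omega>)\<^sup>2) = (\<lambda>\<omega>. (T k \<omega>)\<^sup>2 + W \<omega> * Y k \<omega> + A \<omega>)"
      by (auto simp: T_Suc W_def A_def power2_eq_square algebra_simps)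
    have "integrable M (\<lambda>\<omega>. (T (Suc k) \<omega>)\<^sup>2)" unfolding eq using Suc WY AI by simp
    moreover have "expectation (\<lambda>\<omega>. (T (Suc k) \<omega>)\<^sup>2) = expectation (\<lambda>\<omega>. (T k \<omega>)\<^sup>2) + expectation A"
      unfolding eq using Suc WY AI orth[OF WG W_bound] by simp
    ultimately show ?case using Suc AE_le by simp
  qed
  have "{\<omega>\<in>space M. \<exists>j\<le>k. l \<le> \<bar>\<Sum>i<j. Y i \<omega>\<bar>} \<subseteq> {\<omega>\<in>space M. l\<^sup>2 \<le> (T k \<omega>)\<^sup>2}"
  proof safe
    fix \<omega> j assume "j \<le> k" "l \<le> \<bar>\<Sum>i<j. Y i \<omega>\<bar>"
    then have "l \<le> \<bar>T k \<omega>\<bar>"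
      using stopped_sum_not_exceeded[of l "\<lambda>i. Y i \<omega>" k] unfolding T_def by force
    then show "l\<^sup>2 \<le> (T k \<omega>)\<^sup>2" using l abs_le_square_iff[of l "T k \<omega>"] by simp
  qed
  then have "prob {\<omega>\<in>space M. \<exists>j\<le>k. l \<le> \<bar>\<Sum>i<j. Y i \<omega>\<bar>} \<le> prob {\<omega>\<in>space M. l\<^sup>2 \<le> (T k \<omega>)\<^sup>2}"
    by (intro finite_measure_mono) auto
  also have "\<dots> \<le> expectation (\<lambda>\<omega>. (T k \<omega>)\<^sup>2) / l\<^sup>2"
    using T2 l by (intro integral_Markov_inequality_measure[where A = "{}"]) auto
  also have "\<dots> \<le> (\<Sum>i<k. expectation (\<lambda>\<omega>. (Y i \<omega>)\<^sup>2)) / l\<^sup>2"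
    using T2 l by (intro divide_right_mono) auto
  finally show ?thesis .
qed

text \<open>Almost sure convergence of an \<open>L\<^sup>2\<close>-bounded martingale, in the form needed here: the maximal inequality applied
  to the tails makes almost every path of partial sums a Cauchy sequence.\<close>

theorem AE_summable_orthogonal:
  fixes Y :: "nat \<Rightarrow> 'a \<Rightarrow> real"
  assumes sub: "\<And>n. subalgebra M (G n)"
    and adapted: "\<And>j k. j < k \<Longrightarrow> Y j \<in> borel_measurable (G k)"
    and sq: "\<And>n. integrable M (\<lambda>\<omega>. (Y n \<omega>)\<^sup>2)"
    and orth: "\<And>n W c. W \<in> borel_measurable (G n) \<Longrightarrow> (\<And>\<omega>. \<bar>W \<omega>\<bar> \<le> c) \<Longrightarrow>
       expectation (\<lambda>\<omega>. W \<omega> * Y n \<omega>) = 0"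
    and summable: "summable (\<lambda>n. expectation (\<lambda>\<omega>. (Y n \<omega>)\<^sup>2))"
  shows "AE \<omega> in M. summable (\<lambda>n. Y n \<omega>)"
proof -
  define v where "v = (\<lambda>n. expectation (\<lambda>\<omega>. (Y n \<omega>)\<^sup>2))"
  have v_nonneg: "0 \<le> v n" for n by (simp add: v_def)
  have YM [measurable]: "Y n \<in> borel_measurable M" for n
    using adapted[of n "Suc n"] sub[of "Suc n"] by (metis lessI measurable_from_subalg)
  have small: "AE \<omega> in M. \<exists>m. \<forall>j. \<bar>\<Sum>i<j. Y (m + i) \<omega>\<bar> < l" if l: "l > 0" for l :: real
  proof -
    \<comment> \<open>\<open>N\<close> is the event that every tail oscillates by at least \<open>l\<close>.\<close>
    define E where "E = (\<lambda>m k. {\<omega>\<in>space M. \<exists>j\<le>k. l \<le> \<bar>\<Sum>i<j. Y (m + i) \<omega>\<bar>})"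
    define N where "N = (\<Inter>m. \<Union>k. E m k)"
    have [measurable]: "E m k \<in> sets M" for m k unfolding E_def by measurable
    have "prob N \<le> (\<Sum>i. v (i + m)) / l\<^sup>2" for m
    proof -
      have E_le: "prob (E m k) \<le> (\<Sum>i. v (i + m)) / l\<^sup>2" for k
      proof -
        have "prob (E m k) \<le> (\<Sum>i<k. v (m + i)) / l\<^sup>2"
          unfolding E_def v_def
          by (rule maximal_inequality_orthogonal[where G = "\<lambda>n. G (m + n)"])
            (use sub adapted sq l in \<open>auto intro: orth\<close>)
        also have "\<dots> \<le> (\<Sum>i. v (i + m)) / l\<^sup>2"
          using summable v_nonneg unfolding v_def[symmetric]
          by (intro divide_right_mono) (auto simp: add.commute summable_iff_shift intro!: sum_le_suminf)
        finally show ?thesis .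
      qed
      have "incseq (E m)" unfolding E_def incseq_def by (auto intro: order_trans)
      then have "(\<lambda>k. prob (E m k)) \<longlonglongrightarrow> prob (\<Union>k. E m k)"
        by (intro finite_Lim_measure_incseq) auto
      then have "prob (\<Union>k. E m k) \<le> (\<Sum>i. v (i + m)) / l\<^sup>2"
        by (rule LIMSEQ_le_const2) (use E_le in auto)
      moreover have "prob N \<le> prob (\<Union>k. E m k)"
        unfolding N_def by (intro finite_measure_mono) auto
      ultimately show ?thesis by simp
    qed
    moreover have "(\<lambda>m. (\<Sum>i. v (i + m)) / l\<^sup>2) \<longlonglongrightarrow> 0 / l\<^sup>2"
      using suminf_exist_split2[OF summable[folded v_def]] l by (intro tendsto_divide) auto
    ultimately have "prob N \<le> 0 / l\<^sup>2" by (intro LIMSEQ_le_const) auto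
    then have "prob N = 0" by (simp add: measure_le_0_iff)
    moreover have "N \<in> sets M" unfolding N_def by measurable
    ultimately have "AE \<omega> in M. \<omega> \<notin> N" by (simp add: prob_eq_0)
    then show ?thesis
    proof (rule AE_mp, intro AE_I2 impI)
      fix \<omega> assume "\<omega> \<in> space M" "\<omega> \<notin> N"
      then obtain m where m: "\<And>k. \<omega> \<notin> E m k" by (auto simp: N_def)
      have "\<bar>\<Sum>i<j. Y (m + i) \<omega>\<bar> < l" for j
        using m[of j] \<open>\<omega> \<in> space M\<close> by (force simp: E_def)
      then show "\<exists>m. \<forall>j. \<bar>\<Sum>i<j. Y (m + i) \<omega>\<bar> < l" by blast
    qed
  qed
  have "AE \<omega> in M. \<forall>q::nat. \<exists>m. \<forall>j. \<bar>\<Sum>i<j. Y (m + i) \<omega>\<bar> < 1 / (q + 1)"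
    unfolding AE_all_countable by (intro allI small) simp
  then show ?thesis
  proof (rule AE_mp, intro AE_I2 impI)
    fix \<omega> assume *: "\<forall>q::nat. \<exists>m. \<forall>j. \<bar>\<Sum>i<j. Y (m + i) \<omega>\<bar> < 1 / (q + 1)"
    show "summable (\<lambda>n. Y n \<omega>)"
      unfolding summable_Cauchy
    proof (intro allI impI)
      fix e :: real assume e: "0 < e"
      obtain q :: nat where q: "1 / (real q + 1) < e / 2"
        using nat_approx_posE[of "e/2"] e by (auto simp: add.commute)
      obtain N where "\<And>j. \<bar>\<Sum>i<j. Y (N + i) \<omega>\<bar> < 1 / (real q + 1)" using * by blast
      then have N: "\<bar>\<Sum>i<j. Y (N + i) \<omega>\<bar> < e / 2" for j using q less_trans by blast
      show "\<exists>N. \<forall>m\<ge>N. \<forall>n. norm (\<Sum>k=m..<n. Y k \<omega>) < e"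
      proof (intro exI[of _ N] allI impI)
        fix m n assume "N \<le> m"
        have from_N: "(\<Sum>k=N..<k. Y k \<omega>) = (\<Sum>i<k-N. Y (N + i) \<omega>)" if "N \<le> k" for k
          using that sum.shift_bounds_nat_ivl[of "\<lambda>k. Y k \<omega>" 0 N "k - N"]
          by (simp add: lessThan_atLeast0 add.commute)
        show "norm (\<Sum>k=m..<n. Y k \<omega>) < e"
        proof (cases "m \<le> n")
          case True
          then have "(\<Sum>k=N..<m. Y k \<omega>) + (\<Sum>k=m..<n. Y k \<omega>) = (\<Sum>k=N..<n. Y k \<omega>)"
            using \<open>N \<le> m\<close> by (intro sum.atLeastLessThan_concat)
          then show ?thesis using N[of "m - N"] N[of "n - N"] from_N[of m] from_N[of n] True \<open>N \<le> m\<close>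
            unfolding real_norm_def by linarith
        qed (use e in simp)
      qed
    qed
  qed
qed

end

section \<open>Averaging out independent noise\<close>

context prob_space
begin

text \<open>The freezing rule: averaging over the noise \<open>u\<close>, which is independent of the past \<open>G\<close>, may be done with the
  past variables \<open>z\<close> and \<open>W\<close> held fixed.  This is Fubini's theorem for the joint law of \<open>(W, z)\<close> and \<open>u\<close>, which is
  a product measure.\<close>

lemma expectation_freeze:
  fixes u :: "'a \<Rightarrow> 'b::euclidean_space" and z :: "'a \<Rightarrow> 'c::euclidean_space"
    and f :: "'c \<times> 'b \<Rightarrow> real"
  assumes G: "subalgebra M G"
    and u [measurable]: "u \<in> borel_measurable M"
    and indep: "indep_set {u -` A \<inter> space M | A. A \<in> sets borel} (sets G)"
    and z: "z \<in> borel_measurable G" and W: "W \<in> borel_measurable G"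
    and f [measurable]: "f \<in> borel_measurable borel"
    and bounded: "\<And>\<omega>. \<bar>W \<omega>\<bar> \<le> c" and int: "integrable M (\<lambda>\<omega>. f (z \<omega>, u \<omega>))"
    and \<phi>: "\<And>v. \<phi> v = expectation (\<lambda>\<omega>. f (v, u \<omega>))"
  shows "integrable M (\<lambda>\<omega>. W \<omega> * \<phi> (z \<omega>))" (is ?I)
    and "expectation (\<lambda>\<omega>. W \<omega> * f (z \<omega>, u \<omega>)) = expectation (\<lambda>\<omega>. W \<omega> * \<phi> (z \<omega>))" (is ?E)
proof -
  have [measurable]: "z \<in> borel_measurable M" "W \<in> borel_measurable M"
    using z W measurable_from_subalg[OF G] by auto
  define V where "V = (\<lambda>\<omega>. (W \<omega>, z \<omega>))"
  have V [measurable]: "V \<in> borel_measurable M" unfolding V_def by measurable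
  have VG: "V \<in> borel_measurable G" unfolding V_def using z W by measurable
  have sp: "space G = space M" using G by (simp add: subalgebra_def)
  interpret PV: prob_space "distr M borel V" by (rule prob_space_distr) simp
  interpret Pu: prob_space "distr M borel u" by (rule prob_space_distr) simp
  interpret P: pair_prob_space "distr M borel V" "distr M borel u" ..
  have joint: "distr M borel V \<Otimes>\<^sub>M distr M borel u = distr M (borel \<Otimes>\<^sub>M borel) (\<lambda>\<omega>. (V \<omega>, u \<omega>))"
  proof (rule pair_measure_eqI)
    fix A B assume "A \<in> sets (distr M borel V)" "B \<in> sets (distr M borel u)"
    then have [measurable]: "A \<in> sets borel" "B \<in> sets borel" by auto
    have "V -` A \<inter> space M \<in> sets G" using measurable_sets[OF VG, of A] sp by simp
    moreover have "u -` B \<inter> space M \<in> {u -` A \<inter> space M | A. A \<in> sets borel}" by auto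
    ultimately have "prob ((u -` B \<inter> space M) \<inter> (V -` A \<inter> space M))
        = prob (u -` B \<inter> space M) * prob (V -` A \<inter> space M)"
      by (intro indep_setD[OF indep])
    moreover have "(\<lambda>\<omega>. (V \<omega>, u \<omega>)) -` (A \<times> B) \<inter> space M = (u -` B \<inter> space M) \<inter> (V -` A \<inter> space M)"
      by auto
    ultimately show "emeasure (distr M borel V) A * emeasure (distr M borel u) B
        = emeasure (distr M (borel \<Otimes>\<^sub>M borel) (\<lambda>\<omega>. (V \<omega>, u \<omega>))) (A \<times> B)"
      by (simp add: emeasure_distr emeasure_eq_measure mult.commute flip: ennreal_mult)
  qed (auto intro: PV.sigma_finite_measure_axioms Pu.sigma_finite_measure_axioms cong: sets_pair_measure_cong)
  define F :: "(real \<times> 'c) \<times> 'b \<Rightarrow> real" where "F = (\<lambda>p. fst (fst p) * f (snd (fst p), snd p))"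
  have F [measurable]: "F \<in> borel_measurable (borel \<Otimes>\<^sub>M borel)"
  proof -
    have "(\<lambda>p::(real \<times> 'c) \<times> 'b. (snd (fst p), snd p)) \<in> borel_measurable borel"
      by (intro borel_measurable_continuous_onI continuous_intros)
    moreover have "(\<lambda>p::(real \<times> 'c) \<times> 'b. fst (fst p)) \<in> borel_measurable borel"
      by (intro borel_measurable_continuous_onI continuous_intros)
    ultimately show ?thesis
      unfolding F_def borel_prod by (intro borel_measurable_times measurable_compose[OF _ f])
  qed
  have "integrable M (\<lambda>\<omega>. W \<omega> * f (z \<omega>, u \<omega>))"
  proof (rule Bochner_Integration.integrable_bound)
    show "integrable M (\<lambda>\<omega>. c * f (z \<omega>, u \<omega>))" using int by simp
    show "AE \<omega> in M. norm (W \<omega> * f (z \<omega>, u \<omega>)) \<le> norm (c * f (z \<omega>, u \<omega>))"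
      using bounded by (auto simp: abs_mult intro!: mult_right_mono order_trans[OF bounded abs_ge_self])
  qed measurable
  then have intF: "integrable (distr M borel V \<Otimes>\<^sub>M distr M borel u) F"
    using F unfolding joint by (subst integrable_distr_eq) (auto simp: F_def V_def)
  have inner: "(\<integral>x. F (v, x) \<partial>distr M borel u) = fst v * \<phi> (snd v)" for v
    by (cases v) (simp add: F_def \<phi> integral_distr)
  have [measurable]: "(\<lambda>v. fst v * \<phi> (snd v)) \<in> borel_measurable (borel :: (real \<times> 'c) measure)"
  proof -
    have "case_prod (\<lambda>v x. F (v, x)) \<in> borel_measurable (borel \<Otimes>\<^sub>M distr M borel u)" by simp
    from Pu.borel_measurable_lebesgue_integral[OF this] show ?thesis by (simp add: inner)
  qed
  show ?I
    using P.integrable_fst'[OF intF] unfolding inner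
    by (subst (asm) integrable_distr_eq) (auto simp: V_def)
  have "expectation (\<lambda>\<omega>. W \<omega> * f (z \<omega>, u \<omega>)) = (\<integral>x. F x \<partial>(distr M borel V \<Otimes>\<^sub>M distr M borel u))"
    using F unfolding joint by (subst integral_distr) (auto simp: F_def V_def)
  also have "\<dots> = (\<integral>v. fst v * \<phi> (snd v) \<partial>distr M borel V)"
    using P.integral_fst'[OF intF] by (simp add: inner)
  also have "\<dots> = expectation (\<lambda>\<omega>. W \<omega> * \<phi> (z \<omega>))"
    by (subst integral_distr) (auto simp: V_def)
  finally show ?E .
qed

text \<open>Conditioning on the small algebra \<open>F\<close> already centres \<open>f (z, u)\<close> with respect to the whole past \<open>G\<close>, because by
  the freezing rule both conditional expectations are the same function of \<open>z\<close>.  This matters for the algorithm: its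
  biases are defined by conditioning on the iterates only, but the estimator noise of earlier steps is not a function
  of the iterates, so the martingale structure is only visible in the larger past.\<close>

lemma cond_exp_frozen_orthogonal:
  fixes u :: "'a \<Rightarrow> 'b::euclidean_space" and z :: "'a \<Rightarrow> 'c::euclidean_space"
    and f :: "'c \<times> 'b \<Rightarrow> real"
  assumes G: "subalgebra M G" and F: "subalgebra G F"
    and u [measurable]: "u \<in> borel_measurable M"
    and indep: "indep_set {u -` A \<inter> space M | A. A \<in> sets borel} (sets G)"
    and z: "z \<in> borel_measurable F" and W: "W \<in> borel_measurable G"
    and f [measurable]: "f \<in> borel_measurable borel"
    and bounded: "\<And>\<omega>. \<bar>W \<omega>\<bar> \<le> c" and int: "integrable M (\<lambda>\<omega>. f (z \<omega>, u \<omega>))"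
  shows "integrable M (\<lambda>\<omega>. W \<omega> * (f (z \<omega>, u \<omega>) - real_cond_exp M F (\<lambda>\<omega>. f (z \<omega>, u \<omega>)) \<omega>))"
    and "expectation (\<lambda>\<omega>. W \<omega> * (f (z \<omega>, u \<omega>) - real_cond_exp M F (\<lambda>\<omega>. f (z \<omega>, u \<omega>)) \<omega>)) = 0"
proof -
  define \<phi> where "\<phi> = (\<lambda>v. expectation (\<lambda>\<omega>. f (v, u \<omega>)))"
  have MF: "subalgebra M F" using G F by (auto simp: subalgebra_def)
  interpret finite_measure_subalgebra M F by unfold_locales (rule MF)
  have zG: "z \<in> borel_measurable G" by (rule measurable_from_subalg[OF F z])
  have zM [measurable]: "z \<in> borel_measurable M" by (rule measurable_from_subalg[OF G zG])
  have WM [measurable]: "W \<in> borel_measurable M" by (rule measurable_from_subalg[OF G W])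
  have \<phi>_eq: "\<phi> v = expectation (\<lambda>\<omega>. f (v, u \<omega>))" for v by (simp add: \<phi>_def)
  note freeze = expectation_freeze[OF G u indep zG _ f _ int \<phi>_eq]
  have \<phi>_meas: "\<phi> \<in> borel_measurable borel"
  proof -
    have D: "prob_space (distr M borel u)" by (rule prob_space_distr) simp
    interpret Pu: prob_space "distr M borel u" by (rule D)
    have "case_prod (\<lambda>v x. f (v, x)) \<in> borel_measurable (borel \<Otimes>\<^sub>M distr M borel u)"
      by (simp add: measurable_cong_sets[OF sets_pair_measure_cong[OF refl sets_distr] refl] borel_prod)
    from Pu.borel_measurable_lebesgue_integral[OF this]
    show ?thesis by (simp add: \<phi>_def integral_distr)
  qed
  have \<phi>zF: "(\<lambda>\<omega>. \<phi> (z \<omega>)) \<in> borel_measurable F" using \<phi>_meas z by measurable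
  have \<phi>z_int: "integrable M (\<lambda>\<omega>. \<phi> (z \<omega>))" using freeze(1)[of "\<lambda>_. 1" 1] by simp
  have ae: "AE \<omega> in M. real_cond_exp M F (\<lambda>\<omega>. f (z \<omega>, u \<omega>)) \<omega> = \<phi> (z \<omega>)"
  proof (rule real_cond_exp_charact[OF _ int \<phi>z_int \<phi>zF])
    fix A assume "A \<in> sets F"
    then have "A \<in> sets G" using F by (auto simp: subalgebra_def)
    then have "(indicator A :: _ \<Rightarrow> real) \<in> borel_measurable G" by simp
    from freeze(2)[OF this, of 1]
    show "(LINT \<omega>:A|M. f (z \<omega>, u \<omega>)) = (LINT \<omega>:A|M. \<phi> (z \<omega>))"
      by (simp add: set_lebesgue_integral_def indicator_def)
  qed
  have int_W: "integrable M (\<lambda>\<omega>. W \<omega> * f (z \<omega>, u \<omega>))"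
  proof (rule Bochner_Integration.integrable_bound)
    show "integrable M (\<lambda>\<omega>. c * f (z \<omega>, u \<omega>))" using int by simp
    show "AE \<omega> in M. norm (W \<omega> * f (z \<omega>, u \<omega>)) \<le> norm (c * f (z \<omega>, u \<omega>))"
      by (auto simp: abs_mult intro!: mult_right_mono order_trans[OF bounded abs_ge_self])
  qed measurable
  have ae': "AE \<omega> in M. W \<omega> * (f (z \<omega>, u \<omega>) - real_cond_exp M F (\<lambda>\<omega>. f (z \<omega>, u \<omega>)) \<omega>)
      = W \<omega> * f (z \<omega>, u \<omega>) - W \<omega> * \<phi> (z \<omega>)"
    using ae by eventually_elim (simp add: algebra_simps)
  have meas: "(\<lambda>\<omega>. W \<omega> * (f (z \<omega>, u \<omega>) - real_cond_exp M F (\<lambda>\<omega>. f (z \<omega>, u \<omega>)) \<omega>)) \<in> borel_measurable M"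
    using int by measurable
  have meas': "(\<lambda>\<omega>. W \<omega> * f (z \<omega>, u \<omega>) - W \<omega> * \<phi> (z \<omega>)) \<in> borel_measurable M"
    using int_W freeze(1)[OF W bounded] by measurable
  show "integrable M (\<lambda>\<omega>. W \<omega> * (f (z \<omega>, u \<omega>) - real_cond_exp M F (\<lambda>\<omega>. f (z \<omega>, u \<omega>)) \<omega>))"
    using integrable_cong_AE[OF meas meas' ae'] int_W freeze(1)[OF W bounded] by simp
  show "expectation (\<lambda>\<omega>. W \<omega> * (f (z \<omega>, u \<omega>) - real_cond_exp M F (\<lambda>\<omega>. f (z \<omega>, u \<omega>)) \<omega>)) = 0"
    using integral_cong_AE[OF meas meas' ae'] int_W freeze[OF W bounded] by simp
qed

end

section \<open>Noise of the gradient estimator\<close>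

context prob_space
begin

lemma AE_summable_of_bounded_means:
  fixes f :: "nat \<Rightarrow> 'a \<Rightarrow> real"
  assumes meas [measurable]: "\<And>n. f n \<in> borel_measurable M" and nonneg: "\<And>n \<omega>. 0 \<le> f n \<omega>"
    and bound: "\<And>n. (\<integral>\<^sup>+\<omega>. f n \<omega> \<partial>M) \<le> ennreal (c n)" and c: "\<And>n. 0 \<le> c n" "summable c"
  shows "AE \<omega> in M. summable (\<lambda>n. f n \<omega>)"
proof -
  have "(\<integral>\<^sup>+\<omega>. (\<Sum>n. ennreal (f n \<omega>)) \<partial>M) = (\<Sum>n. \<integral>\<^sup>+\<omega>. f n \<omega> \<partial>M)"
    by (rule nn_integral_suminf) simp
  also have "\<dots> \<le> (\<Sum>n. ennreal (c n))" by (intro suminf_le bound) auto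
  also have "\<dots> = ennreal (\<Sum>n. c n)" using c by (intro suminf_ennreal2)
  finally have "(\<integral>\<^sup>+\<omega>. (\<Sum>n. ennreal (f n \<omega>)) \<partial>M) \<noteq> \<infinity>"
    using ennreal_less_top[of "suminf c"] by (auto simp: top_unique)
  then have "AE \<omega> in M. (\<Sum>n. ennreal (f n \<omega>)) \<noteq> \<infinity>"
    by (intro nn_integral_PInf_AE) measurable
  then show ?thesis
    by eventually_elim (auto intro: summable_suminf_not_top nonneg)
qed

text \<open>The accumulated effect of the centred estimator \<open>g n\<close> along the directions \<open>d (z n)\<close> converges.  Coordinatewise,
  \<open>d (z n)\<close> is a bounded function of the past, so the increments are orthogonal to the past, and their second moments
  are of the order of \<open>(\<alpha> n)\<^sup>2\<close>.\<close>

lemma AE_summable_estimator_noise: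
  fixes u :: "nat \<Rightarrow> 'a \<Rightarrow> 'b::euclidean_space" and z :: "nat \<Rightarrow> 'a \<Rightarrow> 'c::euclidean_space"
    and f :: "nat \<Rightarrow> 'c \<times> 'b \<Rightarrow> 'd::euclidean_space" and d :: "'c \<Rightarrow> 'd"
  assumes G: "\<And>n. subalgebra M (G n)" and F: "\<And>j k. j \<le> k \<Longrightarrow> subalgebra (G k) (F j)"
    and u: "\<And>j k. j < k \<Longrightarrow> u j \<in> borel_measurable (G k)"
    and indep: "\<And>n. indep_set {u n -` A \<inter> space M | A. A \<in> sets borel} (sets (G n))"
    and z: "\<And>n. z n \<in> borel_measurable (F n)"
    and f [measurable]: "\<And>n. f n \<in> borel_measurable borel"
    and d [measurable]: "d \<in> borel_measurable borel"
    and d_bound: "\<And>n \<omega>. \<omega> \<in> space M \<Longrightarrow> norm (d (z n \<omega>)) \<le> \<Delta>"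
  defines "g \<equiv> \<lambda>n \<omega>. f n (z n \<omega>, u n \<omega>)"
  assumes second_moment: "\<And>n. (\<integral>\<^sup>+\<omega>. ennreal ((norm (g n \<omega>))\<^sup>2) \<partial>M) \<le> ennreal K"
    and mean_bound: "\<And>n. AE \<omega> in M. norm (vec_cond_exp M (F n) (g n) \<omega>) \<le> b"
    and \<alpha>: "summable (\<lambda>n. (\<alpha> n)\<^sup>2)" and K: "0 \<le> K"
  shows "AE \<omega> in M. summable (\<lambda>n. \<alpha> n * ((g n \<omega> - vec_cond_exp M (F n) (g n) \<omega>) \<bullet> d (z n \<omega>)))"
proof -
  have zG: "z j \<in> borel_measurable (G k)" if "j \<le> k" for j k
    using measurable_from_subalg[OF F[OF that] z] .
  have zM [measurable]: "z n \<in> borel_measurable M" for n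
    using measurable_from_subalg[OF G zG] by blast
  have uM [measurable]: "u n \<in> borel_measurable M" for n
    using measurable_from_subalg[OF G u[of n "Suc n"]] by blast
  have gM [measurable]: "g n \<in> borel_measurable M" for n unfolding g_def by measurable
  define c where "c = (\<lambda>n. vec_cond_exp M (F n) (g n))"
  define Y where "Y = (\<lambda>n \<omega>. \<alpha> n * ((g n \<omega> - c n \<omega>) \<bullet> d (z n \<omega>)))"
  have cF: "c n \<in> borel_measurable (F n)" for n unfolding c_def vec_cond_exp_def by measurable
  have adapted: "Y j \<in> borel_measurable (G k)" if "j < k" for j k
  proof -
    have [measurable]: "z j \<in> borel_measurable (G k)" "u j \<in> borel_measurable (G k)"
      "c j \<in> borel_measurable (G k)"
      using that zG u measurable_from_subalg[OF F cF] by auto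
    show ?thesis unfolding Y_def g_def by measurable
  qed
  have cM [measurable]: "c n \<in> borel_measurable M" for n
    using measurable_from_subalg[OF G measurable_from_subalg[OF F cF]] by blast
  have YM [measurable]: "Y n \<in> borel_measurable M" for n unfolding Y_def by measurable
  have g2: "integrable M (\<lambda>\<omega>. (norm (g n \<omega>))\<^sup>2)" for n
    using second_moment[of n] by (intro integrableI_bounded) (auto intro: le_less_trans)
  have g2_le: "expectation (\<lambda>\<omega>. (norm (g n \<omega>))\<^sup>2) \<le> K" for n
    using second_moment[of n] K by (simp add: nn_integral_eq_integral[OF g2])
  have g_int: "integrable M (\<lambda>\<omega>. g n \<omega> \<bullet> e)" for n e
  proof -
    have "integrable M (\<lambda>\<omega>. norm (g n \<omega>))"
      by (rule square_integrable_imp_integrable[OF _ g2]) measurable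
    then have "integrable M (g n)" by (simp add: integrable_norm_iff)
    then show ?thesis by simp
  qed
  have Y_sq_bound: "AE \<omega> in M. (Y n \<omega>)\<^sup>2 \<le> (2 * \<Delta>\<^sup>2) * ((\<alpha> n)\<^sup>2 * ((norm (g n \<omega>))\<^sup>2 + b\<^sup>2))" for n
    using mean_bound[of n] AE_space
  proof eventually_elim
    case (elim \<omega>)
    have "\<bar>(g n \<omega> - c n \<omega>) \<bullet> d (z n \<omega>)\<bar> \<le> norm (g n \<omega> - c n \<omega>) * norm (d (z n \<omega>))"
      by (rule Cauchy_Schwarz_ineq2)
    also have "\<dots> \<le> (norm (g n \<omega>) + b) * \<Delta>"
    proof (rule mult_mono)
      show le: "norm (g n \<omega> - c n \<omega>) \<le> norm (g n \<omega>) + b"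
        using elim norm_triangle_ineq4[of "g n \<omega>" "c n \<omega>"] by (simp add: c_def)
      show "0 \<le> norm (g n \<omega>) + b" using order_trans[OF norm_ge_zero le] .
    qed (use elim d_bound in auto)
    finally have "((g n \<omega> - c n \<omega>) \<bullet> d (z n \<omega>))\<^sup>2 \<le> ((norm (g n \<omega>) + b) * \<Delta>)\<^sup>2"
      by (metis abs_ge_zero power2_abs power_mono)
    also have "\<dots> = \<Delta>\<^sup>2 * (norm (g n \<omega>) + b)\<^sup>2" by (simp add: power_mult_distrib)
    also have "\<dots> \<le> \<Delta>\<^sup>2 * (2 * ((norm (g n \<omega>))\<^sup>2 + b\<^sup>2))"
      using sum_squares_bound[of "norm (g n \<omega>)" b] by (intro mult_left_mono) (auto simp: power2_sum)
    finally have "(\<alpha> n)\<^sup>2 * ((g n \<omega> - c n \<omega>) \<bullet> d (z n \<omega>))\<^sup>2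
        \<le> (\<alpha> n)\<^sup>2 * (\<Delta>\<^sup>2 * (2 * ((norm (g n \<omega>))\<^sup>2 + b\<^sup>2)))"
      by (rule mult_left_mono) simp
    then show ?case unfolding Y_def power_mult_distrib by (simp only: mult_ac)
  qed
  have dom: "integrable M (\<lambda>\<omega>. (2 * \<Delta>\<^sup>2) * ((\<alpha> n)\<^sup>2 * ((norm (g n \<omega>))\<^sup>2 + b\<^sup>2)))" for n
    using g2 by simp
  have sq: "integrable M (\<lambda>\<omega>. (Y n \<omega>)\<^sup>2)" for n
    by (rule Bochner_Integration.integrable_bound[OF dom]) (use Y_sq_bound[of n] in \<open>auto elim!: eventually_mono\<close>)
  have "expectation (\<lambda>\<omega>. (Y n \<omega>)\<^sup>2) \<le> (2 * \<Delta>\<^sup>2 * (K + b\<^sup>2)) * (\<alpha> n)\<^sup>2" for n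
  proof -
    have "expectation (\<lambda>\<omega>. (Y n \<omega>)\<^sup>2) \<le> expectation (\<lambda>\<omega>. (2 * \<Delta>\<^sup>2) * ((\<alpha> n)\<^sup>2 * ((norm (g n \<omega>))\<^sup>2 + b\<^sup>2)))"
      by (rule integral_mono_AE[OF sq dom Y_sq_bound])
    also have "\<dots> = (2 * \<Delta>\<^sup>2) * ((\<alpha> n)\<^sup>2 * (expectation (\<lambda>\<omega>. (norm (g n \<omega>))\<^sup>2) + b\<^sup>2))"
      using g2[of n] by (simp add: prob_space)
    also have "\<dots> \<le> (2 * \<Delta>\<^sup>2) * ((\<alpha> n)\<^sup>2 * (K + b\<^sup>2))"
      using g2_le by (intro mult_left_mono add_right_mono) auto
    finally show ?thesis by (simp add: mult_ac)
  qed
  then have summable_sq: "summable (\<lambda>n. expectation (\<lambda>\<omega>. (Y n \<omega>)\<^sup>2))"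
    by (intro summable_comparison_test'[OF summable_mult[OF \<alpha>], of 0]) auto
  have orth: "expectation (\<lambda>\<omega>. W \<omega> * Y n \<omega>) = 0"
    if W: "W \<in> borel_measurable (G n)" and W_bound: "\<And>\<omega>. \<bar>W \<omega>\<bar> \<le> w" for W w n
  proof -
    \<comment> \<open>The indicator makes \<open>V\<close> bounded everywhere, since \<open>d\<close> is only controlled on the sample space.\<close>
    define V where "V = (\<lambda>e \<omega>. W \<omega> * (d (z n \<omega>) \<bullet> e) * indicator (space M) \<omega>)"
    have sp: "space (G n) = space M" using G[of n] by (simp add: subalgebra_def)
    have VG: "V e \<in> borel_measurable (G n)" for e
    proof -
      have [measurable]: "z n \<in> borel_measurable (G n)" "W \<in> borel_measurable (G n)"
        "space M \<in> sets (G n)" using zG W sp sets.top[of "G n"] by auto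
      show ?thesis unfolding V_def by measurable
    qed
    have V_bound: "\<bar>V e \<omega>\<bar> \<le> w * (\<Delta> * norm e)" for e \<omega>
    proof (cases "\<omega> \<in> space M")
      case True
      have "\<bar>d (z n \<omega>) \<bullet> e\<bar> \<le> norm (d (z n \<omega>)) * norm e" by (rule Cauchy_Schwarz_ineq2)
      also have "\<dots> \<le> \<Delta> * norm e" using d_bound[OF True] by (intro mult_right_mono) auto
      finally show ?thesis
        using W_bound[of \<omega>] True order_trans[OF abs_ge_zero W_bound]
        by (auto simp: V_def abs_mult intro!: mult_mono)
    next
      case False
      obtain \<omega>0 where "\<omega>0 \<in> space M" using not_empty by blast
      then have "0 \<le> \<Delta>" using d_bound order_trans[OF norm_ge_zero] by blast
      then show ?thesis using False order_trans[OF abs_ge_zero W_bound[of \<omega>]] by (simp add: V_def)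
    qed
    have fe: "(\<lambda>p. f n p \<bullet> e) \<in> borel_measurable borel" for e by measurable
    note frozen = cond_exp_frozen_orthogonal[OF G F[OF order_refl] uM indep z VG fe V_bound,
        folded g_def, OF g_int[unfolded g_def]]
    have "expectation (\<lambda>\<omega>. W \<omega> * Y n \<omega>) = expectation (\<lambda>\<omega>. \<alpha> n *
        (\<Sum>e\<in>Basis. V e \<omega> * (g n \<omega> \<bullet> e - real_cond_exp M (F n) (\<lambda>\<omega>. g n \<omega> \<bullet> e) \<omega>)))"
    proof (rule Bochner_Integration.integral_cong[OF refl])
      fix \<omega> assume \<omega>: "\<omega> \<in> space M"
      have "(g n \<omega> - c n \<omega>) \<bullet> d (z n \<omega>) = (\<Sum>e\<in>Basis. ((g n \<omega> - c n \<omega>) \<bullet> e) * (d (z n \<omega>) \<bullet> e))"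
        by (rule euclidean_inner)
      also have "\<dots> = (\<Sum>e\<in>Basis. (g n \<omega> \<bullet> e - real_cond_exp M (F n) (\<lambda>\<omega>. g n \<omega> \<bullet> e) \<omega>) * (d (z n \<omega>) \<bullet> e))"
        by (intro sum.cong refl) (simp add: inner_diff_left c_def vec_cond_exp_def)
      finally show "W \<omega> * Y n \<omega> = \<alpha> n *
        (\<Sum>e\<in>Basis. V e \<omega> * (g n \<omega> \<bullet> e - real_cond_exp M (F n) (\<lambda>\<omega>. g n \<omega> \<bullet> e) \<omega>))"
        using \<omega> by (simp add: Y_def V_def sum_distrib_left mult_ac)
    qed
    also have "\<dots> = 0" using frozen by (simp add: g_def)
    finally show ?thesis .
  qed
  have "AE \<omega> in M. summable (\<lambda>n. Y n \<omega>)"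
    by (rule AE_summable_orthogonal[OF G adapted sq orth summable_sq])
  then show ?thesis by (simp add: Y_def c_def)
qed

end

lemma space_generated_sigma [simp]: "space (generated_sigma M I X) = space M"
  unfolding generated_sigma_def by (rule space_measure_of) auto

lemma sets_generated_sigma:
  "sets (generated_sigma M I X) = sigma_sets (space M) (\<Union>i\<in>I. {X i -` A \<inter> space M | A. A \<in> sets borel})"
  unfolding generated_sigma_def by (rule sets_measure_of) auto

lemma measurable_generated_sigma:
  fixes X :: "'i \<Rightarrow> 'w \<Rightarrow> 'a::topological_space"
  assumes "i \<in> I"
  shows "X i \<in> borel_measurable (generated_sigma M I X)"
proof (rule measurableI)
  fix A assume "A \<in> sets (borel :: 'a measure)"
  then show "X i -` A \<inter> space (generated_sigma M I X) \<in> sets (generated_sigma M I X)"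
    using assms unfolding sets_generated_sigma by (intro sigma_sets.Basic) auto
qed simp

lemma sets_generated_sigma_subset:
  assumes sp: "space N = space M" and X: "\<And>i. i \<in> I \<Longrightarrow> X i \<in> borel_measurable N"
  shows "sets (generated_sigma M I X) \<subseteq> sets N"
  unfolding sets_generated_sigma sp[symmetric]
  by (rule sets.sigma_sets_subset) (use measurable_sets[OF X] in auto)

lemma space_szspmd_past [simp]: "space (szspmd_past M u z n) = space M"
  unfolding szspmd_past_def
  by (rule space_measure_of) (metis space_generated_sigma sets.space_closed Un_least)

lemma sets_szspmd_past:
  "sets (szspmd_past M u z n)
   = sigma_sets (space M) (sets (generated_sigma M {..n} z) \<union> sets (generated_sigma M {..<n} u))"
  unfolding szspmd_past_def
  by (rule sets_measure_of) (metis space_generated_sigma sets.space_closed Un_least)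

lemma subalgebra_past_iterates:
  assumes "j \<le> n"
  shows "subalgebra (szspmd_past M u z n) (generated_sigma M {..j} z)"
proof -
  have "sets (generated_sigma M {..j} z) \<subseteq> sets (generated_sigma M {..n} z)"
    using assms by (intro sets_generated_sigma_subset measurable_generated_sigma) auto
  also have "\<dots> \<subseteq> sets (szspmd_past M u z n)"
    unfolding sets_szspmd_past by (intro subsetI sigma_sets.Basic UnI1)
  finally show ?thesis by (simp add: subalgebra_def)
qed

lemma measurable_past_noise:
  assumes "j < n"
  shows "u j \<in> borel_measurable (szspmd_past M u z n)"
proof -
  have "subalgebra (szspmd_past M u z n) (generated_sigma M {..<n} u)"
    unfolding subalgebra_def sets_szspmd_past
    by (intro conjI) (simp, intro subsetI sigma_sets.Basic UnI2)
  then show ?thesis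
    by (rule measurable_from_subalg) (use assms in \<open>simp add: measurable_generated_sigma\<close>)
qed

lemma subalgebra_past:
  assumes "\<And>n. z n \<in> borel_measurable M" "\<And>n. u n \<in> borel_measurable M"
  shows "subalgebra M (szspmd_past M u z n)"
  unfolding subalgebra_def
proof (intro conjI)
  show "sets (szspmd_past M u z n) \<subseteq> sets M"
    unfolding sets_szspmd_past using assms
    by (intro sets.sigma_sets_subset Un_least sets_generated_sigma_subset) auto
qed simp

text \<open>The basis of a product space is the disjoint union of the two bases, so the coordinatewise conditional expectation
  splits exactly, not just almost everywhere.\<close>

lemma vec_cond_exp_Pair:
  "vec_cond_exp M F f \<omega> = (vec_cond_exp M F (\<lambda>\<omega>. fst (f \<omega>)) \<omega>, vec_cond_exp M F (\<lambda>\<omega>. snd (f \<omega>)) \<omega>)"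
proof -
  have "vec_cond_exp M F f \<omega> = (\<Sum>i\<in>Basis. (real_cond_exp M F (\<lambda>\<omega>. fst (f \<omega>) \<bullet> i) \<omega> *\<^sub>R i, 0))
      + (\<Sum>i\<in>Basis. (0, real_cond_exp M F (\<lambda>\<omega>. snd (f \<omega>) \<bullet> i) \<omega> *\<^sub>R i))"
    unfolding vec_cond_exp_def by (subst sum_Basis_prod_eq) (simp add: inner_prod_def)
  then show ?thesis
    by (simp add: vec_cond_exp_def sum_prod prod_eq_iff fst_sum snd_sum)
qed

section \<open>The field of a convex-concave function and its mirror descent\<close>

text \<open>Turns the gradient of a convex-concave function into a monotone field, the pseudo-gradient
  \<open>(\<nabla>\<^sub>x L, - \<nabla>\<^sub>y L)\<close>: descent in the first and ascent in the second variable become one descent.\<close>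

definition flip_snd :: "'a::real_inner \<times> 'b::real_inner \<Rightarrow> 'a \<times> 'b" where
  "flip_snd v = (fst v, - snd v)"

lemma norm_flip_snd [simp]: "norm (flip_snd v) = norm v"
  by (simp add: flip_snd_def norm_prod_def)

lemma inner_flip_snd: "flip_snd v \<bullet> w = v \<bullet> flip_snd w"
  by (simp add: flip_snd_def inner_prod_def)

lemma continuous_on_flip_snd [continuous_intros]:
  "continuous_on S f \<Longrightarrow> continuous_on S (\<lambda>x. flip_snd (f x))"
  unfolding flip_snd_def by (intro continuous_intros)

lemma GDERIV_partial:
  fixes L :: "'a::real_inner \<times> 'b::real_inner \<Rightarrow> real"
  assumes "GDERIV L (x, y) :> D"
  shows "GDERIV (\<lambda>x. L (x, y)) x :> fst D" and "GDERIV (\<lambda>y. L (x, y)) y :> snd D"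
proof -
  have L: "(L has_derivative (\<lambda>h. h \<bullet> D)) (at (x, y))" using assms by (simp add: gderiv_def)
  have "((\<lambda>x. (x, y)) has_derivative (\<lambda>h. (h, 0))) (at x)"
    by (intro has_derivative_Pair has_derivative_ident has_derivative_const)
  from has_derivative_compose[OF this L] show "GDERIV (\<lambda>x. L (x, y)) x :> fst D"
    by (simp add: gderiv_def inner_prod_def)
  have "((\<lambda>y. (x, y)) has_derivative (\<lambda>h. (0, h))) (at y)"
    by (intro has_derivative_Pair has_derivative_ident has_derivative_const)
  from has_derivative_compose[OF this L] show "GDERIV (\<lambda>y. L (x, y)) y :> snd D"
    by (simp add: gderiv_def inner_prod_def)
qed

lemma grad_partials:
  fixes L :: "'a::euclidean_space \<times> 'b::euclidean_space \<Rightarrow> real"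
  assumes "continuously_differentiable L"
  shows "(grad_fst L z, grad_snd L z) = grad L z"
proof -
  have "L differentiable (at z)" using assms unfolding continuously_differentiable_def by blast
  then have "GDERIV L (fst z, snd z) :> grad L z" using GDERIV_grad by simp
  from grad_eqI[OF GDERIV_partial(1)[OF this]] grad_eqI[OF GDERIV_partial(2)[OF this]]
  show ?thesis by (simp add: grad_fst_def grad_snd_def)
qed

text \<open>The sum of the two tangent inequalities, for \<open>L\<close> in the first and for \<open>- L\<close> in the second variable; the value
  \<open>L (x, y)\<close> cancels.\<close>

lemma saddle_gap_le_field:
  fixes L :: "'a::euclidean_space \<times> 'b::euclidean_space \<Rightarrow> real"
  assumes L: "continuously_differentiable L"
      "\<And>y. convex_on UNIV (\<lambda>x. L (x, y))" "\<And>x. concave_on UNIV (\<lambda>y. L (x, y))"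
  shows "L (x, y') - L (x', y) \<le> flip_snd (grad L (x, y)) \<bullet> ((x, y) - (x', y'))"
proof -
  define D where "D = grad L (x, y)"
  have D: "GDERIV L (x, y) :> D"
    unfolding D_def using L(1) by (intro GDERIV_grad) (simp add: continuously_differentiable_def)
  have "L (x, y) + fst D \<bullet> (x' - x) \<le> L (x', y)"
    using strongly_convex_on_tangent[of 0 UNIV "\<lambda>x. L (x, y)" x x', OF _ _ _ GDERIV_partial(1)[OF D]] L(2)
    by (simp add: strongly_convex_on_zero)
  moreover have "- L (x, y) + (- snd D) \<bullet> (y' - y) \<le> - L (x, y')"
    using strongly_convex_on_tangent[of 0 UNIV "\<lambda>y. - L (x, y)" y y',
        OF _ _ _ GDERIV_minus[OF GDERIV_partial(2)[OF D]]] L(3)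
    by (simp add: strongly_convex_on_zero concave_on_def)
  ultimately show ?thesis
    by (simp add: flip_snd_def inner_prod_def D_def[symmetric] inner_diff_right)
qed

text \<open>At a saddle point the gap of the previous lemma is the sum of two nonnegative differences through the saddle value;
  \<open>L (x', y')\<close>, one of which is positive in the strict case.\<close>

lemma field_nonneg_at_saddle:
  fixes L :: "'a::euclidean_space \<times> 'b::euclidean_space \<Rightarrow> real"
  assumes L: "continuously_differentiable L"
      "\<And>y. convex_on UNIV (\<lambda>x. L (x, y))" "\<And>x. concave_on UNIV (\<lambda>y. L (x, y))"
    and p: "(x', y') \<in> saddle_points X Y L" and z: "x \<in> X" "y \<in> Y"
  shows "0 \<le> flip_snd (grad L (x, y)) \<bullet> ((x, y) - (x', y'))"
    and "L (x', y) < L (x', y') \<or> L (x', y') < L (x, y') \<Longrightarrow>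
      0 < flip_snd (grad L (x, y)) \<bullet> ((x, y) - (x', y'))"
proof -
  have "L (x', y) \<le> L (x', y')" "L (x', y') \<le> L (x, y')"
    using p z by (auto simp: saddle_points_def)
  then show "0 \<le> flip_snd (grad L (x, y)) \<bullet> ((x, y) - (x', y'))"
    "L (x', y) < L (x', y') \<or> L (x', y') < L (x, y') \<Longrightarrow>
      0 < flip_snd (grad L (x, y)) \<bullet> ((x, y) - (x', y'))"
    using saddle_gap_le_field[OF L, of x y' x' y] by auto
qed

definition joint_bregman ::
    "('a::real_inner \<Rightarrow> ereal) \<Rightarrow> ('b::real_inner \<Rightarrow> ereal) \<Rightarrow> 'a \<times> 'b \<Rightarrow> 'a \<times> 'b \<Rightarrow> real" where
  "joint_bregman Rx Ry p z = bregman Rx (fst p) (fst z) + bregman Ry (snd p) (snd z)"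

lemma joint_bregman_ge:
  fixes X :: "'a::euclidean_space set" and Y :: "'b::euclidean_space set"
  assumes "regularizer \<sigma> \<rho> X Rx" "regularizer \<sigma> \<rho> Y Ry" "p \<in> X \<times> Y" "z \<in> X \<times> Y"
  shows "\<sigma> / 2 * (norm (p - z))\<^sup>2 \<le> joint_bregman Rx Ry p z"
  using bregman_ge[OF assms(1), of "fst p" "fst z"] bregman_ge[OF assms(2), of "snd p" "snd z"] assms(3,4)
  by (auto simp: joint_bregman_def norm_prod_def algebra_simps)

lemma continuous_on_joint_bregman:
  fixes X :: "'a::euclidean_space set" and Y :: "'b::euclidean_space set"
  assumes "regularizer \<sigma> \<rho> X Rx" "regularizer \<sigma> \<rho> Y Ry"
  shows "continuous_on (X \<times> Y) (joint_bregman Rx Ry p)"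
  unfolding joint_bregman_def
  by (intro continuous_intros continuous_on_compose2[OF continuous_on_bregman[OF assms(1)]]
      continuous_on_compose2[OF continuous_on_bregman[OF assms(2)]]) auto

lemma joint_bregman_mirror_step:
  fixes X :: "'a::euclidean_space set" and Y :: "'b::euclidean_space set"
  assumes X: "X \<noteq> {}" "convex X" "compact X" and Y: "Y \<noteq> {}" "convex Y" "compact Y"
    and R: "\<sigma> > 0" "regularizer \<sigma> \<rho> X Rx" "regularizer \<sigma> \<rho> Y Ry"
    and p: "p \<in> X \<times> Y" and z: "z \<in> X \<times> Y"
  shows "joint_bregman Rx Ry p
      (mirror_map X Rx (grad (\<lambda>x. real_of_ereal (Rx x)) (fst z) - a *\<^sub>R fst g),
       mirror_map Y Ry (grad (\<lambda>y. real_of_ereal (Ry y)) (snd z) + a *\<^sub>R snd g))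
     \<le> joint_bregman Rx Ry p z - a * (g \<bullet> flip_snd (z - p)) + a\<^sup>2 * (norm g)\<^sup>2 / (2 * \<sigma>)"
  using bregman_mirror_step[OF X R(1,2), of "fst p" "fst z" "a *\<^sub>R fst g"]
    bregman_mirror_step[OF Y R(1,3), of "snd p" "snd z" "- a *\<^sub>R snd g"] p z
  by (auto simp: joint_bregman_def flip_snd_def inner_prod_def norm_prod_def power_mult_distrib
      distrib_left add_divide_distrib algebra_simps)

lemma szspmd_Suc:
  assumes "szspmd X Y L Rx Ry \<alpha> \<mu> M u z" and "\<omega> \<in> space M"
  shows "z (Suc n) \<omega> =
    (mirror_map X Rx (grad (\<lambda>x. real_of_ereal (Rx x)) (fst (z n \<omega>))
       - \<alpha> n *\<^sub>R fst (zo_grad L (\<mu> n) (z n \<omega>) (u n \<omega>))),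
     mirror_map Y Ry (grad (\<lambda>y. real_of_ereal (Ry y)) (snd (z n \<omega>))
       + \<alpha> n *\<^sub>R snd (zo_grad L (\<mu> n) (z n \<omega>) (u n \<omega>))))"
proof -
  have "\<forall>n. \<forall>\<omega>\<in>space M. z (Suc n) \<omega> =
      (mirror_map X Rx (grad (\<lambda>x. real_of_ereal (Rx x)) (fst (z n \<omega>))
         - \<alpha> n *\<^sub>R fst (zo_grad L (\<mu> n) (z n \<omega>) (u n \<omega>))),
       mirror_map Y Ry (grad (\<lambda>y. real_of_ereal (Ry y)) (snd (z n \<omega>))
         + \<alpha> n *\<^sub>R snd (zo_grad L (\<mu> n) (z n \<omega>) (u n \<omega>))))"
    using assms(1) unfolding szspmd_def by (elim conjE)
  then show ?thesis using assms(2) by blast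
qed

lemma szspmd_iterates_in:
  fixes X :: "'a::euclidean_space set" and Y :: "'b::euclidean_space set"
  assumes X: "X \<noteq> {}" "convex X" "compact X" and Y: "Y \<noteq> {}" "convex Y" "compact Y"
    and R: "\<sigma> > 0" "regularizer \<sigma> \<rho> X Rx" "regularizer \<sigma> \<rho> Y Ry"
    and alg: "szspmd X Y L Rx Ry \<alpha> \<mu> M u z" and \<omega>: "\<omega> \<in> space M"
  shows "z n \<omega> \<in> X \<times> Y"
proof (cases n)
  case 0 then show ?thesis using alg \<omega> by (simp add: szspmd_def)
next
  case (Suc k)
  then show ?thesis
    using szspmd_Suc[OF alg \<omega>] mirror_map_argmax(1)[OF X R(1,2)] mirror_map_argmax(1)[OF Y R(1,3)]
    by simp
qed

text \<open>Both stochastic error series of the divergence recursion converge almost surely: the quadratic terms because the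
  second moments are bounded, the linear noise terms because they are square-summable martingale increments.\<close>

lemma szspmd_estimator:
  fixes X :: "'a::euclidean_space set" and Y :: "'b::euclidean_space set"
    and L :: "'a \<times> 'b \<Rightarrow> real"
  assumes X: "X \<noteq> {}" "convex X" "compact X" and Y: "Y \<noteq> {}" "convex Y" "compact Y"
    and L: "continuous_on UNIV L"
    and R: "\<sigma> > 0" "regularizer \<sigma> \<rho> X Rx" "regularizer \<sigma> \<rho> Y Ry"
    and alg: "szspmd X Y L Rx Ry \<alpha> \<mu> M u z"
    and est: "estimator_bounds L \<mu> M u z C K" and K: "0 < K"
    and mean_bound: "AE \<omega> in M. \<forall>n. norm (vec_cond_exp M (generated_sigma M {..n} z)
         (\<lambda>\<omega>. zo_grad L (\<mu> n) (z n \<omega>) (u n \<omega>)) \<omega>) \<le> b"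
    and \<alpha>: "summable (\<lambda>n. (\<alpha> n)\<^sup>2)"
  defines "g \<equiv> \<lambda>n \<omega>. zo_grad L (\<mu> n) (z n \<omega>) (u n \<omega>)"
  shows "AE \<omega> in M. summable (\<lambda>n. (\<alpha> n)\<^sup>2 * (norm (g n \<omega>))\<^sup>2)"
    and "AE \<omega> in M. summable (\<lambda>n. \<alpha> n *
       ((g n \<omega> - vec_cond_exp M (generated_sigma M {..n} z) (g n) \<omega>) \<bullet> flip_snd (z n \<omega> - p)))"
proof -
  interpret prob_space M using alg by (simp add: szspmd_def)
  have z_in: "z n \<omega> \<in> X \<times> Y" if "\<omega> \<in> space M" for n \<omega>
    by (rule szspmd_iterates_in[OF X Y R alg that])
  have zM: "z n \<in> borel_measurable M" for n using alg by (simp add: szspmd_def)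
  have uM: "u n \<in> borel_measurable M" for n
  proof -
    have "standard_normal M (u n)" using alg by (simp add: szspmd_def)
    then have "u n \<in> measurable M lborel" unfolding standard_normal_def by (rule distributed_measurable)
    then show ?thesis by simp
  qed
  define f where "f = (\<lambda>n (v::('a \<times> 'b) \<times> ('a \<times> 'b)). zo_grad L (\<mu> n) (fst v) (snd v))"
  have f: "f n \<in> borel_measurable borel" for n
    unfolding f_def zo_grad_def divide_inverse
    by (intro borel_measurable_continuous_onI continuous_intros continuous_on_compose2[OF L]) auto
  have past: "subalgebra M (szspmd_past M u z n)" for n by (rule subalgebra_past[OF zM uM])
  have F: "subalgebra M (generated_sigma M {..n} z)" for n
    using past[of n] subalgebra_past_iterates[of n n M u z] by (auto simp: subalgebra_def)
  have gM: "g n \<in> borel_measurable M" for n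
  proof -
    have "(\<lambda>\<omega>. (z n \<omega>, u n \<omega>)) \<in> borel_measurable M" using zM uM by measurable
    from measurable_compose[OF this f[of n]] show ?thesis by (simp add: f_def g_def)
  qed
  have second_moment: "(\<integral>\<^sup>+\<omega>. ennreal ((norm (g n \<omega>))\<^sup>2) \<partial>M) \<le> ennreal K" for n
  proof -
    interpret F: finite_measure_subalgebra M "generated_sigma M {..n} z"
      by unfold_locales (rule F)
    have "(\<integral>\<^sup>+\<omega>. ennreal ((norm (g n \<omega>))\<^sup>2) \<partial>M)
        = (\<integral>\<^sup>+\<omega>. nn_cond_exp M (generated_sigma M {..n} z) (\<lambda>\<omega>. ennreal ((norm (g n \<omega>))\<^sup>2)) \<omega> \<partial>M)"
      using F.nn_cond_exp_intg[of "\<lambda>_. 1" "\<lambda>\<omega>. ennreal ((norm (g n \<omega>))\<^sup>2)"] gM[of n] by simp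
    also have "\<dots> \<le> (\<integral>\<^sup>+\<omega>. ennreal K \<partial>M)"
      using est unfolding estimator_bounds_def g_def by (intro nn_integral_mono_AE) (auto elim!: eventually_mono)
    also have "\<dots> = ennreal K" by (simp add: emeasure_space_1)
    finally show ?thesis .
  qed
  show "AE \<omega> in M. summable (\<lambda>n. (\<alpha> n)\<^sup>2 * (norm (g n \<omega>))\<^sup>2)"
  proof (rule AE_summable_of_bounded_means)
    show "summable (\<lambda>n. (\<alpha> n)\<^sup>2 * K)" using \<alpha> by (rule summable_mult2)
    show "(\<integral>\<^sup>+\<omega>. ennreal ((\<alpha> n)\<^sup>2 * (norm (g n \<omega>))\<^sup>2) \<partial>M) \<le> ennreal ((\<alpha> n)\<^sup>2 * K)" for n
      using second_moment[of n] K gM[of n]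
      by (simp add: ennreal_mult nn_integral_cmult mult_left_mono)
  qed (use gM K in auto)
  have "bounded (X \<times> Y)" using X(3) Y(3) by (intro compact_imp_bounded compact_Times)
  then obtain \<Delta> where \<Delta>: "\<And>v. v \<in> X \<times> Y \<Longrightarrow> norm v \<le> \<Delta>" unfolding bounded_iff by blast
  have "AE \<omega> in M. summable (\<lambda>n. \<alpha> n * ((f n (z n \<omega>, u n \<omega>)
      - vec_cond_exp M (generated_sigma M {..n} z) (\<lambda>\<omega>. f n (z n \<omega>, u n \<omega>)) \<omega>)
      \<bullet> flip_snd (z n \<omega> - p)))"
  proof (rule AE_summable_estimator_noise[where G = "szspmd_past M u z" and b = b and K = K
        and \<Delta> = "\<Delta> + norm p"])
    show "subalgebra (szspmd_past M u z k) (generated_sigma M {..j} z)" if "j \<le> k" for j k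
      by (rule subalgebra_past_iterates[OF that])
    show "u j \<in> borel_measurable (szspmd_past M u z k)" if "j < k" for j k
      by (rule measurable_past_noise[OF that])
    show "indep_set {u n -` A \<inter> space M |A. A \<in> sets borel} (sets (szspmd_past M u z n))" for n
    proof -
      have "indep_set (sets (generated_sigma M {n} u)) (sets (szspmd_past M u z n))"
        using alg by (simp add: szspmd_def)
      moreover have "{u n -` A \<inter> space M |A. A \<in> sets borel} \<subseteq> sets (generated_sigma M {n} u)"
        using measurable_sets[OF measurable_generated_sigma[of n "{n}" u M]] by auto
      ultimately show ?thesis unfolding indep_sets2_eq by (meson subset_iff)
    qed
    show "z n \<in> borel_measurable (generated_sigma M {..n} z)" for n
      by (rule measurable_generated_sigma) simp
    show "(\<lambda>v. flip_snd (v - p)) \<in> borel_measurable borel"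
      by (intro borel_measurable_continuous_onI continuous_intros)
    show "norm (flip_snd (z n \<omega> - p)) \<le> \<Delta> + norm p" if "\<omega> \<in> space M" for n \<omega>
      using \<Delta>[OF z_in[OF that, of n]] norm_triangle_ineq4[of "z n \<omega>" p] by simp
    show "(\<integral>\<^sup>+\<omega>. ennreal ((norm (f n (z n \<omega>, u n \<omega>)))\<^sup>2) \<partial>M) \<le> ennreal K" for n
      using second_moment[of n] by (simp add: f_def g_def)
    show "AE \<omega> in M. norm (vec_cond_exp M (generated_sigma M {..n} z) (\<lambda>\<omega>. f n (z n \<omega>, u n \<omega>)) \<omega>) \<le> b" for n
      using mean_bound by (auto simp: f_def elim!: eventually_mono)
  qed (use past f \<alpha> K in auto)
  then show "AE \<omega> in M. summable (\<lambda>n. \<alpha> n *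
       ((g n \<omega> - vec_cond_exp M (generated_sigma M {..n} z) (g n) \<omega>) \<bullet> flip_snd (z n \<omega> - p)))"
    by (simp add: f_def g_def)
qed

text \<open>The data that the excursion argument uses, chosen from the problem alone and so independent of any run of the
  algorithm: finitely many saddle points \<open>Q\<close> whose divergence balls cover the set of saddle points, and one point \<open>pbar\<close>
  towards which the field points, with a uniform rate \<open>h\<close>, from everywhere outside these balls.\<close>

lemma saddle_lyapunov_data:
  fixes X :: "'a::euclidean_space set" and Y :: "'b::euclidean_space set"
    and L :: "'a \<times> 'b \<Rightarrow> real"
  assumes X: "convex X" "compact X" and Y: "convex Y" "compact Y"
    and L: "continuously_differentiable L"
      "\<And>y. convex_on UNIV (\<lambda>x. L (x, y))" "\<And>x. concave_on UNIV (\<lambda>y. L (x, y))"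
    and R: "regularizer \<sigma> \<rho> X Rx" "regularizer \<sigma> \<rho> Y Ry"
    and S: "saddle_points X Y L \<noteq> {}" "compact (saddle_points X Y L)"
      "\<And>x y. (x, y) \<in> (X \<times> Y) - saddle_points X Y L \<Longrightarrow>
         \<exists>(xs, ys)\<in>saddle_points X Y L. L (xs, y) < L (xs, ys) \<or> L (xs, ys) < L (x, ys)"
    and \<eta>: "\<eta> > 0"
  obtains Q pbar h w where "finite Q" "Q \<subseteq> saddle_points X Y L" "pbar \<in> X \<times> Y" "h > 0"
    "\<And>z. z \<in> X \<times> Y \<Longrightarrow> \<forall>q\<in>Q. \<eta> \<le> joint_bregman Rx Ry q z \<Longrightarrow>
       h \<le> flip_snd (grad L z) \<bullet> (z - pbar)"
    "\<And>z. z \<in> X \<times> Y \<Longrightarrow> joint_bregman Rx Ry pbar z \<le> w" "0 \<le> w"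
proof -
  let ?S = "saddle_points X Y L" and ?D = "joint_bregman Rx Ry"
  have S_sub: "?S \<subseteq> X \<times> Y" by (auto simp: saddle_points_def)
  have Z: "compact (X \<times> Y)" "convex (X \<times> Y)"
    using X Y by (auto intro: compact_Times convex_Times)
  have D_cont: "continuous_on (X \<times> Y) (?D q)" for q by (rule continuous_on_joint_bregman[OF R])
  have D_self: "?D q q = 0" for q by (simp add: joint_bregman_def)
  obtain Q where Q: "finite Q" "Q \<subseteq> ?S" "\<And>z. z \<in> ?S \<Longrightarrow> \<exists>q\<in>Q. 0 < \<eta> - ?D q z"
  proof (rule finite_positive_subfamily[where f = "\<lambda>q z. \<eta> - ?D q z", OF S(2)])
    show "continuous_on ?S (\<lambda>z. \<eta> - ?D q z)" for q
      by (intro continuous_intros continuous_on_subset[OF D_cont S_sub])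
    show "\<exists>q\<in>?S. 0 < \<eta> - ?D q z" if "z \<in> ?S" for z
      using that \<eta> D_self by (intro bexI[of _ z]) auto
  qed (rule that)
  define K where "K = {z \<in> X \<times> Y. \<forall>q\<in>Q. \<eta> \<le> ?D q z}"
  have K: "compact K"
  proof -
    have cl: "closed (X \<times> Y \<inter> ?D q -` {\<eta>..})" for q
      using Z(1) by (intro continuous_closed_preimage D_cont compact_imp_closed closed_atLeast)
    have K_eq: "K = X \<times> Y \<inter> (\<Inter>q\<in>Q. X \<times> Y \<inter> ?D q -` {\<eta>..})" by (auto simp: K_def)
    show ?thesis unfolding K_eq by (intro compact_Int_closed Z(1) closed_INT ballI cl)
  qed
  have K_disj: "z \<notin> ?S" if "z \<in> K" for z using Q(3)[of z] that by (force simp: K_def)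
  obtain pbar h where pbar: "pbar \<in> convex hull ?S" and h: "h > 0"
    "\<And>z. z \<in> K \<Longrightarrow> h \<le> flip_snd (grad L z) \<bullet> (z - pbar)"
  proof (rule uniform_descent_direction[OF K _ S(1), where g = "\<lambda>z. flip_snd (grad L z)"])
    show "continuous_on K (\<lambda>z. flip_snd (grad L z))"
      using L(1) unfolding continuously_differentiable_def
      by (intro continuous_intros) (auto intro: continuous_on_subset)
  next
    fix p z assume p: "p \<in> ?S" and "z \<in> K"
    then have "fst z \<in> X" "snd z \<in> Y" by (auto simp: K_def)
    then show "0 \<le> flip_snd (grad L z) \<bullet> (z - p)"
      using field_nonneg_at_saddle(1)[OF L, of "fst p" "snd p" X Y "fst z" "snd z"] p by simp
  next
    fix z assume z: "z \<in> K"
    then have zXY: "fst z \<in> X" "snd z \<in> Y" by (auto simp: K_def)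
    obtain xs ys where "(xs, ys) \<in> ?S" "L (xs, snd z) < L (xs, ys) \<or> L (xs, ys) < L (fst z, ys)"
      using S(3)[of "fst z" "snd z"] K_disj[OF z] zXY by (auto simp: mem_Times_iff)
    then show "\<exists>p\<in>?S. 0 < flip_snd (grad L z) \<bullet> (z - p)"
      using field_nonneg_at_saddle(2)[OF L _ zXY, of xs ys] by (intro bexI[of _ "(xs, ys)"]) auto
  qed (rule that)
  have pbar_in: "pbar \<in> X \<times> Y" using pbar hull_minimal[of ?S "X \<times> Y" convex] S_sub Z(2) by blast
  have "bounded (?D pbar ` (X \<times> Y))"
    by (intro compact_imp_bounded compact_continuous_image D_cont Z(1))
  then obtain w where w: "\<And>z. z \<in> X \<times> Y \<Longrightarrow> \<bar>?D pbar z\<bar> \<le> w"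
    unfolding bounded_iff by (auto simp del: mem_Times_iff)
  have "h \<le> flip_snd (grad L z) \<bullet> (z - pbar)"
    if "z \<in> X \<times> Y" "\<forall>q\<in>Q. \<eta> \<le> ?D q z" for z
    using that by (intro h(2)) (simp add: K_def)
  moreover have "?D pbar z \<le> w" if "z \<in> X \<times> Y" for z using w[OF that] by simp
  moreover have "0 \<le> w" using w[OF pbar_in] by simp
  ultimately show ?thesis by (rule that[OF Q(1,2) pbar_in h(1)])
qed

section \<open>Convergence to a neighbourhood of the saddle points\<close>

theorem theorem5:
  fixes X :: "(real ^ 'n) set" and Y :: "(real ^ 'm) set"
    and L :: "(real ^ 'n) \<times> (real ^ 'm) \<Rightarrow> real"
    and Rx :: "real ^ 'n \<Rightarrow> ereal" and Ry :: "real ^ 'm \<Rightarrow> ereal"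
    and \<sigma>R \<rho>R G K2 \<rho>L :: real
  assumes X: "X \<noteq> {}" "convex X" "compact X"
    and Y: "Y \<noteq> {}" "convex Y" "compact Y"
    and L: "continuously_differentiable L"
      "\<And>y. convex_on UNIV (\<lambda>x. L (x, y))" "\<And>x. concave_on UNIV (\<lambda>y. L (x, y))"
    and R: "\<sigma>R > 0" "regularizer \<sigma>R \<rho>R X Rx" "regularizer \<sigma>R \<rho>R Y Ry"
    and A1: "saddle_points X Y L \<noteq> {}" "compact (saddle_points X Y L)"
      "\<And>x y. (x, y) \<in> (X \<times> Y) - saddle_points X Y L \<Longrightarrow>
         \<exists>(xs, ys)\<in>saddle_points X Y L. L (xs, y) < L (xs, ys) \<or> L (xs, ys) < L (x, ys)"
    and A3: "G > 0" "\<And>z. z \<in> X \<times> Y \<Longrightarrow> norm (grad_fst L z) \<le> G \<and> norm (grad_snd L z) \<le> G"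
    and A7: "K2 > 0"
      "\<And>x1 x2. x1 \<in> X \<Longrightarrow> x2 \<in> X \<Longrightarrow>
         norm (hessian (\<lambda>x. real_of_ereal (Rx x)) x1 - hessian (\<lambda>x. real_of_ereal (Rx x)) x2)
           \<le> K2 * norm (x1 - x2)"
      "\<And>y1 y2. y1 \<in> Y \<Longrightarrow> y2 \<in> Y \<Longrightarrow>
         norm (hessian (\<lambda>y. real_of_ereal (Ry y)) y1 - hessian (\<lambda>y. real_of_ereal (Ry y)) y2)
           \<le> K2 * norm (y1 - y2)"
    and A8: "\<rho>L > 0"
      "\<And>z1 z2. z1 \<in> X \<times> Y \<Longrightarrow> z2 \<in> X \<times> Y \<Longrightarrow>
         norm (grad L z1 - grad L z2) \<le> \<rho>L * norm (z1 - z2)"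
  shows "\<forall>\<epsilon>>0. \<exists>B>0. \<forall>\<alpha> \<mu> (M :: 'w measure) u z.
           szspmd X Y L Rx Ry \<alpha> \<mu> M u z \<longrightarrow>
           \<not> summable \<alpha> \<longrightarrow> summable (\<lambda>n. (\<alpha> n)\<^sup>2) \<longrightarrow>
           (\<exists>C>0. \<exists>K>0. estimator_bounds L \<mu> M u z C K) \<longrightarrow>
           (AE \<omega> in M. \<forall>n. norm (bias_fst L \<mu> M u z n \<omega>) \<le> B \<and>
                              norm (bias_snd L \<mu> M u z n \<omega>) \<le> B) \<longrightarrow>
           (AE \<omega> in M. \<exists>n0. \<forall>n\<ge>n0. z n \<omega> \<in> neighbourhood \<epsilon> (saddle_points X Y L))"
proof (intro allI impI)
  fix \<epsilon> :: real assume \<epsilon>: "\<epsilon> > 0"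
  let ?S = "saddle_points X Y L" and ?D = "joint_bregman Rx Ry"
  \<comment> \<open>With this value a divergence of at most \<open>3 * \<eta>\<close> means a distance of at most \<open>\<epsilon>\<close>.\<close>
  define \<eta> where "\<eta> = \<sigma>R * \<epsilon>\<^sup>2 / 6"
  have \<eta>: "\<eta> > 0" using R(1) \<epsilon> by (simp add: \<eta>_def)
  obtain Q pbar h w where Q: "finite Q" "Q \<subseteq> ?S" and pbar: "pbar \<in> X \<times> Y" and h: "h > 0"
    and descent: "\<And>z. z \<in> X \<times> Y \<Longrightarrow> \<forall>q\<in>Q. \<eta> \<le> ?D q z \<Longrightarrow>
       h \<le> flip_snd (grad L z) \<bullet> (z - pbar)"
    and w: "\<And>z. z \<in> X \<times> Y \<Longrightarrow> ?D pbar z \<le> w" "0 \<le> w"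
    by (rule saddle_lyapunov_data[OF X(2,3) Y(2,3) L R(2,3) A1 \<eta>]) (assumption, rule that, assumption+)
  have Q_in: "q \<in> X \<times> Y" if "q \<in> Q" for q using that Q(2) by (auto simp: saddle_points_def)
  have D_nonneg: "0 \<le> ?D p z" if "p \<in> X \<times> Y" "z \<in> X \<times> Y" for p z
    using R(1) by (intro order_trans[OF _ joint_bregman_ge[OF R(2,3) that]]) simp
  have "bounded (X \<times> Y)" using X(3) Y(3) by (intro compact_imp_bounded compact_Times)
  then obtain r where r: "r > 0" "\<And>v. v \<in> X \<times> Y \<Longrightarrow> norm v \<le> r" unfolding bounded_pos by blast
  define \<Delta> where "\<Delta> = 2 * r"
  have \<Delta>: "\<Delta> > 0" "\<And>p z. p \<in> X \<times> Y \<Longrightarrow> z \<in> X \<times> Y \<Longrightarrow> norm (z - p) \<le> \<Delta>"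
  proof -
    show "norm (z - p) \<le> \<Delta>" if "p \<in> X \<times> Y" "z \<in> X \<times> Y" for p z
      using r(2)[OF that(1)] r(2)[OF that(2)] norm_triangle_ineq4[of z p] by (simp add: \<Delta>_def)
  qed (use r in \<open>simp add: \<Delta>_def\<close>)
  \<comment> \<open>\<open>T\<close> bounds the duration of an excursion when half of the rate \<open>h\<close> is given up to the bias.\<close>
  define T where "T = 1 + (w + 1) / (h / 2)"
  have T: "T > 0" using w(2) h by (simp add: T_def add_pos_nonneg)
  define \<beta> where "\<beta> = min (h / 2) (\<eta> / T)"
  have \<beta>: "\<beta> > 0" "\<beta> \<le> h / 2" "\<beta> * T \<le> \<eta>"
    using h \<eta> T by (auto simp: \<beta>_def field_simps min_def)
  \<comment> \<open>Two bias components of norm at most \<open>B\<close>, paired with a vector of norm at most \<open>\<Delta>\<close>, give a drift of at most \<open>\<beta>\<close>.\<close>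
  define B where "B = \<beta> / (2 * \<Delta>)"
  have B: "B > 0" "2 * B * \<Delta> = \<beta>" using \<beta>(1) \<Delta>(1) by (auto simp: B_def)
  show "\<exists>B>0. \<forall>\<alpha> \<mu> (M :: 'w measure) u z.
           szspmd X Y L Rx Ry \<alpha> \<mu> M u z \<longrightarrow>
           \<not> summable \<alpha> \<longrightarrow> summable (\<lambda>n. (\<alpha> n)\<^sup>2) \<longrightarrow>
           (\<exists>C>0. \<exists>K>0. estimator_bounds L \<mu> M u z C K) \<longrightarrow>
           (AE \<omega> in M. \<forall>n. norm (bias_fst L \<mu> M u z n \<omega>) \<le> B \<and>
                              norm (bias_snd L \<mu> M u z n \<omega>) \<le> B) \<longrightarrow>
           (AE \<omega> in M. \<exists>n0. \<forall>n\<ge>n0. z n \<omega> \<in> neighbourhood \<epsilon> (saddle_points X Y L))"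
  proof (rule exI[of _ B], intro conjI allI impI)
    show "B > 0" by (rule B(1))
  next
    fix \<alpha> \<mu> :: "nat \<Rightarrow> real" and M :: "'w measure" and u z :: "nat \<Rightarrow> 'w \<Rightarrow> (real ^ 'n) \<times> (real ^ 'm)"
    assume alg: "szspmd X Y L Rx Ry \<alpha> \<mu> M u z" and \<alpha>: "\<not> summable \<alpha>" "summable (\<lambda>n. (\<alpha> n)\<^sup>2)"
      and est: "\<exists>C>0. \<exists>K>0. estimator_bounds L \<mu> M u z C K"
      and bias: "AE \<omega> in M. \<forall>n. norm (bias_fst L \<mu> M u z n \<omega>) \<le> B \<and> norm (bias_snd L \<mu> M u z n \<omega>) \<le> B"
    obtain C K where K: "K > 0" "estimator_bounds L \<mu> M u z C K" using est by blast
    have \<alpha>_pos: "\<alpha> n > 0" for n using alg by (simp add: szspmd_def)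
    have "(\<lambda>n. sqrt ((\<alpha> n)\<^sup>2)) \<longlonglongrightarrow> sqrt 0"
      by (intro tendsto_real_sqrt summable_LIMSEQ_zero \<alpha>(2))
    then have \<alpha>_lim: "\<alpha> \<longlonglongrightarrow> 0" using \<alpha>_pos by (simp add: less_imp_le)
    define g where "g = (\<lambda>n \<omega>. zo_grad L (\<mu> n) (z n \<omega>) (u n \<omega>))"
    define c where "c = (\<lambda>n. vec_cond_exp M (generated_sigma M {..n} z) (g n))"
    have c_eq: "c n \<omega> = grad L (z n \<omega>) + (bias_fst L \<mu> M u z n \<omega>, bias_snd L \<mu> M u z n \<omega>)" for n \<omega>
      unfolding c_def g_def vec_cond_exp_Pair[of M _ "\<lambda>\<omega>. zo_grad L (\<mu> n) (z n \<omega>) (u n \<omega>)"]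
        grad_partials[OF L(1), symmetric]
      by (simp add: bias_fst_def bias_snd_def)
    have L_cont: "continuous_on UNIV L"
      using L(1) unfolding continuously_differentiable_def
      by (intro continuous_at_imp_continuous_on ballI differentiable_imp_continuous_within) auto
    have z_in: "z n \<omega> \<in> X \<times> Y" if "\<omega> \<in> space M" for n \<omega>
      by (rule szspmd_iterates_in[OF X Y R alg that])
    have mean_bound: "AE \<omega> in M. \<forall>n. norm (c n \<omega>) \<le> 2 * G + 2 * B"
      using bias AE_space
    proof eventually_elim
      case (elim \<omega>)
      show ?case
      proof
        fix n
        have "norm (c n \<omega>) \<le> norm (grad L (z n \<omega>)) + norm (bias_fst L \<mu> M u z n \<omega>, bias_snd L \<mu> M u z n \<omega>)"
          unfolding c_eq by (rule norm_triangle_ineq)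
        also have "\<dots> \<le> (norm (grad_fst L (z n \<omega>)) + norm (grad_snd L (z n \<omega>)))
            + (norm (bias_fst L \<mu> M u z n \<omega>) + norm (bias_snd L \<mu> M u z n \<omega>))"
          unfolding grad_partials[OF L(1), symmetric] by (intro add_mono norm_Pair_le)
        also have "\<dots> \<le> (G + G) + (B + B)"
          using elim A3(2)[OF z_in[OF elim(2), of n]] by (intro add_mono) auto
        finally show "norm (c n \<omega>) \<le> 2 * G + 2 * B" by simp
      qed
    qed
    note estimator = szspmd_estimator[OF X Y L_cont R alg K(2,1)
        mean_bound[unfolded c_def g_def] \<alpha>(2)]
    have squares: "AE \<omega> in M. summable (\<lambda>n. (\<alpha> n)\<^sup>2 * (norm (g n \<omega>))\<^sup>2)"
      using estimator(1) by (simp add: g_def)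
    have noise: "AE \<omega> in M. \<forall>p\<in>insert pbar Q.
        summable (\<lambda>n. \<alpha> n * ((g n \<omega> - c n \<omega>) \<bullet> flip_snd (z n \<omega> - p)))"
      using Q(1) estimator(2) by (intro AE_finite_allI) (simp_all add: c_def g_def)
    show "AE \<omega> in M. \<exists>n0. \<forall>n\<ge>n0. z n \<omega> \<in> neighbourhood \<epsilon> ?S"
      using noise squares bias AE_space
    proof eventually_elim
      case (elim \<omega>)
      define e where "e = (\<lambda>p n. (\<alpha> n)\<^sup>2 * (norm (g n \<omega>))\<^sup>2 / (2 * \<sigma>R)
          - \<alpha> n * ((g n \<omega> - c n \<omega>) \<bullet> flip_snd (z n \<omega> - p)))"
      have e: "summable (e p)" if "p \<in> insert pbar Q" for p
        unfolding e_def using elim(1,2) that by (intro summable_diff summable_divide) auto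
      have step: "?D p (z (Suc n) \<omega>)
          \<le> ?D p (z n \<omega>) - \<alpha> n * (flip_snd (grad L (z n \<omega>)) \<bullet> (z n \<omega> - p)) + \<alpha> n * \<beta> + e p n"
        if p: "p \<in> X \<times> Y" for p n
      proof -
        define b where "b = (bias_fst L \<mu> M u z n \<omega>, bias_snd L \<mu> M u z n \<omega>)"
        have "norm b \<le> B + B"
          unfolding b_def using elim(3) by (intro order_trans[OF norm_Pair_le] add_mono) auto
        then have "norm b * norm (z n \<omega> - p) \<le> (2 * B) * \<Delta>"
          using \<Delta>(2)[OF p z_in[OF elim(4)]] B(1) by (intro mult_mono) auto
        then have "\<bar>b \<bullet> flip_snd (z n \<omega> - p)\<bar> \<le> \<beta>"
          using Cauchy_Schwarz_ineq2[of b "flip_snd (z n \<omega> - p)"] B(2) by simp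
        then have "\<alpha> n * (- (b \<bullet> flip_snd (z n \<omega> - p))) \<le> \<alpha> n * \<beta>"
          using \<alpha>_pos[of n] by (intro mult_left_mono) auto
        moreover have "?D p (z (Suc n) \<omega>)
            \<le> ?D p (z n \<omega>) - \<alpha> n * (g n \<omega> \<bullet> flip_snd (z n \<omega> - p)) + (\<alpha> n)\<^sup>2 * (norm (g n \<omega>))\<^sup>2 / (2 * \<sigma>R)"
          unfolding szspmd_Suc[OF alg elim(4)] g_def
          by (rule joint_bregman_mirror_step[OF X Y R p z_in[OF elim(4)]])
        moreover have "g n \<omega> \<bullet> flip_snd (z n \<omega> - p) = flip_snd (grad L (z n \<omega>)) \<bullet> (z n \<omega> - p)
            + b \<bullet> flip_snd (z n \<omega> - p) + (g n \<omega> - c n \<omega>) \<bullet> flip_snd (z n \<omega> - p)"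
          unfolding c_eq b_def[symmetric] inner_flip_snd inner_diff_left inner_add_left by simp
        ultimately show ?thesis unfolding e_def by (simp only: distrib_left mult_minus_right)
      qed
      have "\<exists>n0. \<forall>n\<ge>n0. \<exists>q\<in>Q. ?D q (z n \<omega>) \<le> 3 * \<eta>"
      proof (rule eventually_stays_near[where \<alpha> = \<alpha> and \<beta> = \<beta> and h = "h / 2" and w = w
            and W = "\<lambda>n. ?D pbar (z n \<omega>)" and e = e and e' = "e pbar"])
        show "?D q (z (Suc n) \<omega>) \<le> ?D q (z n \<omega>) + \<alpha> n * \<beta> + e q n" if q: "q \<in> Q" for q n
        proof -
          have "q \<in> ?S" "z n \<omega> \<in> X \<times> Y" using q Q(2) z_in[OF elim(4)] by auto
          then have "0 \<le> flip_snd (grad L (z n \<omega>)) \<bullet> (z n \<omega> - q)"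
            using field_nonneg_at_saddle(1)[OF L, of "fst q" "snd q" X Y "fst (z n \<omega>)" "snd (z n \<omega>)"]
            by auto
          then have "0 \<le> \<alpha> n * (flip_snd (grad L (z n \<omega>)) \<bullet> (z n \<omega> - q))"
            using \<alpha>_pos[of n] by simp
          then show ?thesis using step[OF Q_in[OF q], of n] by simp
        qed
        show "?D pbar (z (Suc n) \<omega>) \<le> ?D pbar (z n \<omega>) - \<alpha> n * (h / 2) + e pbar n"
          if "\<And>q. q \<in> Q \<Longrightarrow> \<eta> \<le> ?D q (z n \<omega>)" for n
        proof -
          have "h \<le> flip_snd (grad L (z n \<omega>)) \<bullet> (z n \<omega> - pbar)"
            using descent[OF z_in[OF elim(4)]] that by blast
          then have "\<alpha> n * (h / 2) \<le> \<alpha> n * (flip_snd (grad L (z n \<omega>)) \<bullet> (z n \<omega> - pbar) - \<beta>)"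
            using \<beta>(2) \<alpha>_pos[of n] by (intro mult_left_mono) auto
          then show ?thesis using step[OF pbar, of n] by (simp add: right_diff_distrib)
        qed
      qed (use Q(1) \<alpha> \<alpha>_pos \<alpha>_lim e h \<eta> \<beta> w D_nonneg[OF pbar] z_in[OF elim(4)] in
          \<open>auto simp: T_def less_imp_le simp del: mem_Times_iff\<close>)
      then obtain n0 where n0: "\<And>n. n \<ge> n0 \<Longrightarrow> \<exists>q\<in>Q. ?D q (z n \<omega>) \<le> 3 * \<eta>" by blast
      have "z n \<omega> \<in> neighbourhood \<epsilon> ?S" if "n \<ge> n0" for n
      proof -
        obtain q where q: "q \<in> Q" "?D q (z n \<omega>) \<le> 3 * \<eta>" using n0[OF \<open>n \<ge> n0\<close>] by blast
        have "\<sigma>R / 2 * (norm (q - z n \<omega>))\<^sup>2 \<le> \<sigma>R / 2 * \<epsilon>\<^sup>2"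
          using joint_bregman_ge[OF R(2,3) Q_in[OF q(1)] z_in[OF elim(4), of n]] q(2)
          by (simp add: \<eta>_def)
        then have "norm (q - z n \<omega>) \<le> \<epsilon>"
          using R(1) \<epsilon> by (simp add: power2_le_iff_abs_le)
        then have "dist (z n \<omega>) q \<le> \<epsilon>" by (simp add: dist_norm norm_minus_commute)
        then show ?thesis
          unfolding neighbourhood_def using infdist_le2[of q ?S "z n \<omega>" \<epsilon>] q(1) Q(2) by auto
      qed
      then show ?case by blast
    qed
  qed
qed

end
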